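(* Let $\mu,\nu$ be Radon measures on $\mathbb R^d$ without common atoms, let $1<p<\infty$, and let $K$ be a kernel that is $L^2_{\mathrm{loc}}(\mu\times\nu)$ off the diagonal and $L^p(\mu)\to L^p(\nu)$ restrictedly bounded. Let $m\in C^\infty(\mathbb R^d)$ be bounded, with $m\equiv0$ in a neighborhood of $0$ and $m\equiv1$ outside some bounded set. For $\varepsilon>0$ let $K_\varepsilon(x,y)=K(x,y)\,m((x-y)/\varepsilon)$ and $T_\varepsilon f(x)=\int K_\varepsilon(x,y)f(y)\,d\mu(y)$ for bounded compactly supported $f$. Then there is $C<\infty$ (depending on $m$ and $K$, but not on $\varepsilon$) such that $\|T_\varepsilon f\|_{L^p(\nu)}\le C\|f\|_{L^p(\mu)}$ for all $\varepsilon>0$ and all bounded compactly supported $f$.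
   Context: A measurable function $K$ on $\mathbb R^d\times\mathbb R^d$ is $L^2_{\mathrm{loc}}(\mu\times\nu)$ off the diagonal if for every $(x_0,y_0)$ with $x_0\neq y_0$ there is a neighborhood $G$ of $(x_0,y_0)$ with $K\mathbf 1_G\in L^2(\mu\times\nu)$. Such $K$ is $L^p(\mu)\to L^p(\nu)$ restrictedly bounded if there is $C$ such that for all $f\in L^\infty(\mu)$, $g\in L^\infty(\nu)$ with separated (disjoint) compact supports, $\left|\iint K(x,y)f(y)g(x)\,d\mu(y)\,d\nu(x)\right|\le C\|f\|_{L^p(\mu)}\|g\|_{L^{p'}(\nu)}$, $1/p+1/p'=1$; the best such $C$ is the restricted norm. *)

theory Defs
  imports "HOL-Analysis.Analysis"
begin

fun Ck :: "nat \<Rightarrow> ('a::euclidean_space \<Rightarrow> real) \<Rightarrow> bool" where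
  "Ck 0 f = continuous_on UNIV f"
| "Ck (Suc n) f = (\<exists>f'. (\<forall>x. (f has_derivative f' x) (at x)) \<and> (\<forall>v. Ck n (\<lambda>x. f' x v)))"

definition smooth :: "('a::euclidean_space \<Rightarrow> real) \<Rightarrow> bool" where
  "smooth f \<longleftrightarrow> (\<forall>n. Ck n f)"

definition radon :: "'a::euclidean_space measure \<Rightarrow> bool" where
  "radon M \<longleftrightarrow> sets M = sets borel \<and> (\<forall>S. compact S \<longrightarrow> emeasure M S < \<infinity>)"

definition Lp_norm :: "'a measure \<Rightarrow> real \<Rightarrow> ('a \<Rightarrow> real) \<Rightarrow> ennreal" where
  "Lp_norm M p f = (let I = (\<integral>\<^sup>+ x. ennreal (\<bar>f x\<bar> powr p) \<partial>M)
                    in if I = \<infinity> then \<infinity> else ennreal (enn2real I powr (1 / p)))"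

definition L2loc_offdiag :: "'a::euclidean_space measure \<Rightarrow> 'a measure \<Rightarrow> ('a \<Rightarrow> 'a \<Rightarrow> real) \<Rightarrow> bool" where
  "L2loc_offdiag \<mu> \<nu> K \<longleftrightarrow>
     (\<forall>x0 y0. x0 \<noteq> y0 \<longrightarrow> (\<exists>G. open G \<and> (x0, y0) \<in> G \<and>
        (\<integral>\<^sup>+ z. ennreal ((indicator G z * K (fst z) (snd z))\<^sup>2) \<partial>(\<nu> \<Otimes>\<^sub>M \<mu>)) < \<infinity>))"

definition bcs :: "'a::euclidean_space measure \<Rightarrow> ('a \<Rightarrow> real) \<Rightarrow> bool" where
  "bcs M f \<longleftrightarrow> f \<in> borel_measurable M \<and> bounded (range f) \<and> (\<exists>S. compact S \<and> (\<forall>y. y \<notin> S \<longrightarrow> f y = 0))"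

definition restr_bounded :: "'a::euclidean_space measure \<Rightarrow> 'a measure \<Rightarrow> real \<Rightarrow> ('a \<Rightarrow> 'a \<Rightarrow> real) \<Rightarrow> bool" where
  "restr_bounded \<mu> \<nu> p K \<longleftrightarrow>
     (\<exists>C. \<forall>f g A B. f \<in> borel_measurable \<mu> \<longrightarrow> bounded (range f) \<longrightarrow>
        g \<in> borel_measurable \<nu> \<longrightarrow> bounded (range g) \<longrightarrow>
        compact A \<longrightarrow> compact B \<longrightarrow> A \<inter> B = {} \<longrightarrow>
        (\<forall>y. y \<notin> A \<longrightarrow> f y = 0) \<longrightarrow> (\<forall>x. x \<notin> B \<longrightarrow> g x = 0) \<longrightarrow>
        ennreal \<bar>\<integral>x. (\<integral>y. K x y * f y \<partial>\<mu>) * g x \<partial>\<nu>\<bar>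
          \<le> ennreal C * Lp_norm \<mu> p f * Lp_norm \<nu> (p / (p - 1)) g)"

end

theory Submission
  imports Defs
begin

text \<open>Write \<open>m((x - y) / \<epsilon>) = 1 - \<phi>((x - y) / \<epsilon>)\<close> with \<open>\<phi>\<close> smooth and compactly supported. Multiplying
  \<open>K\<close> by \<open>u(x) v(y)\<close> with bounded \<open>u\<close>, \<open>v\<close> preserves restricted boundedness, because \<open>u\<close> and \<open>v\<close> can
  be absorbed into \<open>g\<close> and \<open>f\<close>; hence so does multiplying by an absolutely convergent superposition of
  such products. For \<open>x\<close> in a cube of side \<open>\<epsilon>\<close>, applying the fundamental theorem of calculus one coordinate
  at a time writes \<open>m((x - y) / \<epsilon>)\<close> as a superposition whose total mass is independent of \<open>\<epsilon>\<close>. Since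
  \<open>\<phi>((x - y) / \<epsilon>)\<close> is supported in \<open>|x - y| \<le> R \<epsilon>\<close>, the cubes can be put together with bounded overlap,
  and the kernels \<open>K\<^sub>\<epsilon>\<close> are restrictedly bounded uniformly in \<open>\<epsilon>\<close>.

  The kernel \<open>K\<^sub>\<epsilon>\<close> vanishes near the diagonal. For \<open>f\<close> and \<open>g\<close> without separated supports, cut space
  into small pieces, let \<open>f\<close> live on a random selection of pieces and \<open>g\<close> on the complementary one; taking
  expectations recovers a quarter of the full bilinear form. The norm bound follows by testing against
  \<open>g = sgn(T f) |T f|\<^sup>p\<^sup>-\<^sup>1\<close> on bounded sets where \<open>T f\<close> is bounded.\<close>

section \<open>Integrals depending on a parameter, norms, and cubes\<close>

text \<open>The bound on \<open>G\<close> depends on the parameter \<open>s\<close> alone, so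
  \<open>W z * G s z\<close> is dominated by the product \<open>H s * W z\<close>, which is
  integrable for the product measure. This is how a superposition over \<open>s\<close> is moved
  outside an integral in the space variables.\<close>

lemma fubini_parameter:
  fixes H :: "'b \<Rightarrow> real" and W :: "'c \<Rightarrow> real" and G :: "'b \<Rightarrow> 'c \<Rightarrow> real"
  assumes "sigma_finite_measure Q" "sigma_finite_measure P"
    and H: "integrable Q H" and W: "integrable P W"
    and G[measurable]: "case_prod G \<in> borel_measurable (Q \<Otimes>\<^sub>M P)"
    and GH: "\<And>s z. \<bar>G s z\<bar> \<le> H s"
  shows "(\<integral>z. W z * (\<integral>s. G s z \<partial>Q) \<partial>P) = (\<integral>s. (\<integral>z. W z * G s z \<partial>P) \<partial>Q)"
    and "integrable Q (\<lambda>s. \<integral>z. W z * G s z \<partial>P)"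
proof -
  interpret pair_sigma_finite Q P
    using assms by (simp add: pair_sigma_finite_def)
  have [measurable]: "H \<in> borel_measurable Q" "W \<in> borel_measurable P"
    using H W by auto
  have HW: "integrable (Q \<Otimes>\<^sub>M P) (\<lambda>(s, z). H s * W z)"
    by (rule Fubini_integrable) (use H W in \<open>auto simp: abs_mult\<close>)
  have WG: "integrable (Q \<Otimes>\<^sub>M P) (\<lambda>(s, z). W z * G s z)"
  proof (rule Bochner_Integration.integrable_bound[OF HW])
    show "(\<lambda>(s, z). W z * G s z) \<in> borel_measurable (Q \<Otimes>\<^sub>M P)"
      by measurable
    have "\<bar>W z * G s z\<bar> \<le> \<bar>H s * W z\<bar>" for s z
      using mult_left_mono[OF GH[of s z], of "\<bar>W z\<bar>"] GH[of s z] by (simp add: abs_mult mult.commute)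
    then show "AE x in Q \<Otimes>\<^sub>M P. norm (case x of (s, z) \<Rightarrow> W z * G s z)
        \<le> norm (case x of (s, z) \<Rightarrow> H s * W z)"
      by auto
  qed
  show "(\<integral>z. W z * (\<integral>s. G s z \<partial>Q) \<partial>P) = (\<integral>s. (\<integral>z. W z * G s z \<partial>P) \<partial>Q)"
    using Fubini_integral[OF WG] by simp
  show "integrable Q (\<lambda>s. \<integral>z. W z * G s z \<partial>P)"
    using integrable_fst'[OF WG] by simp
qed

text \<open>Hoelder recovered from Young by homogeneity: rescale both quantities to size at most 1,
  where Young's right-hand side is at most 1/p + 1/q = 1.\<close>

lemma le_product_of_scaled_Young:
  fixes X D u v p q :: real
  assumes p: "1 < p" and q: "q = p / (p - 1)" and "0 \<le> D" "0 \<le> u" "0 \<le> v"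
    and le: "\<And>a b. 0 < a \<Longrightarrow> 0 < b \<Longrightarrow> a * b * X \<le> D * ((a * u) powr p / p + (b * v) powr q / q)"
  shows "X \<le> D * u * v"
proof -
  have pq: "1 / p + 1 / q = 1" "0 < q"
    using p by (auto simp: q field_simps)
  \<comment> \<open>Normalising by \<open>u + d\<close> and \<open>v + d\<close> instead of
    \<open>u\<close> and \<open>v\<close> covers vanishing norms; afterwards \<open>d\<close> tends
    to 0.\<close>
  have X: "X \<le> D * ((u + d) * (v + d))" if "0 < d" for d
  proof -
    have pos: "0 < u + d" "0 < v + d"
      using that assms by auto
    have powr1: "(u / (u + d)) powr p \<le> 1" "(v / (v + d)) powr q \<le> 1"
      using that assms pq by (auto intro!: powr_le1)
    have "X / ((u + d) * (v + d)) \<le> D * ((u / (u + d)) powr p / p + (v / (v + d)) powr q / q)"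
      using le[of "1 / (u + d)" "1 / (v + d)"] pos by simp
    also have "\<dots> \<le> D * (1 / p + 1 / q)"
      using powr1 p pq assms by (intro mult_left_mono add_mono divide_right_mono) auto
    finally have "X / ((u + d) * (v + d)) \<le> D"
      by (simp add: pq)
    then show ?thesis
      using pos by (simp add: divide_le_eq)
  qed
  have "((\<lambda>d. D * ((u + d) * (v + d))) \<longlongrightarrow> D * ((u + 0) * (v + 0))) (at_right 0)"
    by (intro tendsto_intros)
  moreover have "eventually (\<lambda>d. X \<le> D * ((u + d) * (v + d))) (at_right 0)"
    using X by (auto simp: eventually_at_filter)
  ultimately have "X \<le> D * ((u + 0) * (v + 0))"
    by (intro tendsto_lowerbound) auto
  then show ?thesis
    by (simp add: mult.assoc)
qed

section \<open>Real-valued norms of bounded functions with bounded support\<close>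

lemma bounded_range_abs:
  fixes f :: "'b \<Rightarrow> real"
  shows "(\<And>x. \<bar>f x\<bar> \<le> M) \<Longrightarrow> bounded (range f)"
  by (auto simp: bounded_iff)

text \<open>A real-valued counterpart of \<open>Lp_norm\<close>. The Bochner integral is 0 for
  non-integrable functions, so it is applied where integrability is known; for \<open>bsupp\<close>
  functions on compact sets \<open>Lp_norm_eq_lpn\<close> identifies the two.\<close>

definition lpn :: "'a measure \<Rightarrow> real \<Rightarrow> ('a \<Rightarrow> real) \<Rightarrow> real" where
  "lpn M p f = (\<integral>x. \<bar>f x\<bar> powr p \<partial>M) powr (1 / p)"

text \<open>Measurability refers to \<open>borel\<close>, so that one predicate serves both
  measures. Compactness of \<open>A\<close> is assumed separately.\<close>

definition bsupp :: "'a::euclidean_space set \<Rightarrow> ('a \<Rightarrow> real) \<Rightarrow> bool" where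
  "bsupp A f \<longleftrightarrow> f \<in> borel_measurable borel \<and> bounded (range f) \<and> (\<forall>y. y \<notin> A \<longrightarrow> f y = 0)"

lemma bsupp_times:
  assumes "bsupp A f" "u \<in> borel_measurable borel" "\<And>x. \<bar>u x\<bar> \<le> M"
  shows "bsupp A (\<lambda>x. u x * f x)"
proof -
  obtain b where b: "\<And>x. \<bar>f x\<bar> \<le> b"
    using assms by (auto simp: bsupp_def bounded_iff)
  have "\<bar>u x * f x\<bar> \<le> M * b" for x
    unfolding abs_mult using assms(3)[of x] b[of x] by (intro mult_mono) auto
  then have "bounded (range (\<lambda>x. u x * f x))"
    by (rule bounded_range_abs)
  then show ?thesis
    using assms by (auto simp: bsupp_def)
qed

lemma bsupp_cmult: "bsupp A f \<Longrightarrow> bsupp A (\<lambda>x. c * f x)"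
  by (rule bsupp_times[where M = "\<bar>c\<bar>"]) auto

lemma radon_finite_on_compact: "radon M \<Longrightarrow> compact A \<Longrightarrow> emeasure M A < \<infinity>"
  by (simp add: radon_def)

lemma radon_sets: "radon M \<Longrightarrow> sets M = sets borel"
  by (simp add: radon_def)

lemma radon_sigma_finite:
  fixes M :: "'a::euclidean_space measure"
  assumes "radon M"
  shows "sigma_finite_measure M"
proof
  have space: "space M = UNIV"
    using radon_sets[OF assms] by (metis sets_eq_imp_space_eq space_borel)
  have "(\<Union>n::nat. cball (0::'a) (real n)) = UNIV"
    by (auto simp: real_arch_simple)
  then show "\<exists>A. countable A \<and> A \<subseteq> sets M \<and> \<Union> A = space M \<and> (\<forall>a\<in>A. emeasure M a \<noteq> \<infinity>)"
    using radon_finite_on_compact[OF assms, OF compact_cball] radon_sets[OF assms] space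
    by (intro exI[of _ "range (\<lambda>n::nat. cball 0 (real n))"]) (force simp: less_top)
qed

lemma radon_integrable_bsupp:
  fixes M :: "'a::euclidean_space measure"
  assumes "radon M" "compact A" "bsupp A f"
  shows "integrable M f"
proof -
  have [measurable_cong]: "sets M = sets borel"
    by (simp add: radon_sets assms)
  obtain b where b: "\<And>x. \<bar>f x\<bar> \<le> b"
    using assms by (auto simp: bsupp_def bounded_iff)
  have A: "A \<in> sets borel"
    using assms by (simp add: borel_compact)
  have "f \<in> borel_measurable M"
    using assms by (simp add: bsupp_def measurable_cong_sets[OF radon_sets[OF assms(1)] refl])
  then show ?thesis
    using assms A b radon_finite_on_compact[OF assms(1,2)]
    by (intro integrableI_bounded_set[where A = A and B = b]) (auto simp: bsupp_def)
qed

lemma bsupp_powr: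
  assumes "bsupp A f" "0 < p"
  shows "bsupp A (\<lambda>x. \<bar>f x\<bar> powr p)"
proof -
  obtain b where b: "\<And>x. \<bar>f x\<bar> \<le> b"
    using assms by (auto simp: bsupp_def bounded_iff)
  have "\<bar>f x\<bar> powr p \<le> b powr p" for x
    using assms b by (intro powr_mono2) auto
  then have "bounded (range (\<lambda>x. \<bar>f x\<bar> powr p))"
    by (intro bounded_range_abs) auto
  moreover have "(\<lambda>x. \<bar>f x\<bar> powr p) \<in> borel_measurable borel"
    using assms by (auto simp: bsupp_def)
  ultimately show ?thesis
    using assms by (auto simp: bsupp_def)
qed

lemma lpn_nonneg: "0 \<le> lpn M p f"
  by (simp add: lpn_def)

lemma lpn_powr: "0 < p \<Longrightarrow> lpn M p f powr p = (\<integral>x. \<bar>f x\<bar> powr p \<partial>M)"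
  by (simp add: lpn_def powr_powr)

lemma lpn_cmult:
  assumes "0 < p" "0 \<le> c"
  shows "lpn M p (\<lambda>x. c * f x) = c * lpn M p f"
  using assms by (simp add: lpn_def abs_mult powr_mult powr_powr)

lemma lpn_mono:
  assumes "radon M" "compact A" "0 < p" "bsupp A f" "bsupp A g" "\<And>x. \<bar>f x\<bar> \<le> \<bar>g x\<bar>"
  shows "lpn M p f \<le> lpn M p g"
  unfolding lpn_def using assms
  by (intro powr_mono2 integral_mono radon_integrable_bsupp[OF assms(1,2) bsupp_powr]) auto

lemma Lp_norm_eq_lpn:
  fixes M :: "'a::euclidean_space measure"
  assumes "radon M" "compact A" "0 < p" "bsupp A f"
  shows "Lp_norm M p f = ennreal (lpn M p f)"
proof -
  have "(\<integral>\<^sup>+ x. ennreal (\<bar>f x\<bar> powr p) \<partial>M) = ennreal (\<integral>x. \<bar>f x\<bar> powr p \<partial>M)"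
    by (rule nn_integral_eq_integral)
      (use assms in \<open>auto intro!: radon_integrable_bsupp[OF assms(1,2) bsupp_powr]\<close>)
  then show ?thesis
    by (simp add: Lp_norm_def lpn_def)
qed

section \<open>Cubes with a moving corner and averages over their position\<close>

lemma cube_indicator_measurable [measurable (raw)]:
  fixes f g :: "'b \<Rightarrow> 'a::euclidean_space"
  assumes [measurable]: "f \<in> borel_measurable N" "g \<in> borel_measurable N"
  shows "(\<lambda>x. indicator (cbox (f x - r *\<^sub>R One) (f x + s *\<^sub>R One)) (g x) :: real) \<in> borel_measurable N"
proof -
  have "indicator (cbox (f x - r *\<^sub>R One) (f x + s *\<^sub>R One)) (g x) =
    (\<Prod>b\<in>Basis. if (f x - r *\<^sub>R One) \<bullet> b \<le> g x \<bullet> b \<and> g x \<bullet> b \<le> (f x + s *\<^sub>R One) \<bullet> b then 1 else 0 :: real)" for x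
    by (auto simp: indicator_def mem_box prod_zero_iff)
  then show ?thesis
    by simp
qed

lemma cube_mem_swap:
  fixes t y :: "'a::euclidean_space"
  shows "y \<in> cbox (t - r *\<^sub>R One) (t + s *\<^sub>R One) \<longleftrightarrow> t \<in> cbox (y - s *\<^sub>R One) (y + r *\<^sub>R One)"
  by (auto simp: mem_box inner_diff_left inner_add_left algebra_simps)

lemma measure_cube:
  fixes y :: "'a::euclidean_space"
  assumes "0 \<le> r + s"
  shows "measure lborel (cbox (y - s *\<^sub>R One) (y + r *\<^sub>R One)) = (r + s) ^ DIM('a)"
  using assms by (subst content_cbox) (auto simp: inner_diff_left inner_add_left)

text \<open>Bounded overlap in continuous form. After exchanging the integrals, the positions
  \<open>t\<close> whose cube contains a fixed \<open>y\<close> again form a cube, of side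
  \<open>r + s\<close>. The box \<open>cbox a b\<close> keeps the range of \<open>t\<close> of
  finite measure for Fubini and can only decrease the integral.\<close>

lemma cube_average:
  fixes M :: "'a::euclidean_space measure" and F :: "'a \<Rightarrow> real" and a b :: 'a
  assumes M: "radon M" and F: "integrable M F" "\<And>y. 0 \<le> F y" and rs: "0 \<le> r + s"
  defines "J \<equiv> \<lambda>t. indicator (cbox a b) t * (\<integral>y. F y * indicator (cbox (t - r *\<^sub>R One) (t + s *\<^sub>R One)) y \<partial>M)"
  shows "integrable lborel J" "(\<integral>t. J t \<partial>lborel) \<le> (r + s) ^ DIM('a) * (\<integral>y. F y \<partial>M)"
proof -
  have [measurable_cong]: "sets M = sets borel"
    using M by (rule radon_sets)
  have [measurable]: "F \<in> borel_measurable M"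
    using F(1) by (rule borel_measurable_integrable)
  let ?Q = "\<lambda>t. cbox (t - r *\<^sub>R One) (t + s *\<^sub>R One)"
  let ?G = "\<lambda>t y. indicator (cbox a b) t * indicator (?Q t) y :: real"
  have H: "integrable lborel (indicator (cbox a b) :: 'a \<Rightarrow> real)"
    by (intro integrable_real_indicator) (auto simp: emeasure_lborel_cbox_eq)
  have G: "(\<lambda>(t, y). ?G t y) \<in> borel_measurable (lborel \<Otimes>\<^sub>M M)"
    by measurable
  have GH: "\<bar>?G t y\<bar> \<le> indicator (cbox a b) t" for t y
    by (auto simp: indicator_def)
  have J: "J = (\<lambda>t. \<integral>y. F y * ?G t y \<partial>M)"
    unfolding J_def integral_mult_right_zero[symmetric]
    by (intro ext Bochner_Integration.integral_cong) (auto simp: ac_simps)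
  note fub = fubini_parameter[OF sigma_finite_lborel radon_sigma_finite[OF M] H F(1) G GH]
  show "integrable lborel J"
    unfolding J by (rule fub(2))
  have cube: "integrable lborel (indicator (cbox (y - s *\<^sub>R One) (y + r *\<^sub>R One)) :: 'a \<Rightarrow> real)" for y
    by (intro integrable_real_indicator) (auto simp: emeasure_lborel_cbox_eq)
  have le: "(\<integral>t. ?G t y \<partial>lborel) \<le> (r + s) ^ DIM('a)" for y
  proof -
    have "(\<integral>t. ?G t y \<partial>lborel) \<le> (\<integral>t. indicator (cbox (y - s *\<^sub>R One) (y + r *\<^sub>R One)) t \<partial>lborel)"
    proof (rule integral_mono)
      show le: "?G t y \<le> indicator (cbox (y - s *\<^sub>R One) (y + r *\<^sub>R One)) t" for t
        by (auto simp: indicator_def cube_mem_swap)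
      show "integrable lborel (\<lambda>t. ?G t y)"
        by (rule Bochner_Integration.integrable_bound[OF cube[of y]]) (use le in auto)
    qed (rule cube)
    then show ?thesis
      by (simp add: measure_cube[OF rs])
  qed
  have "(\<integral>t. J t \<partial>lborel) = (\<integral>y. F y * (\<integral>t. ?G t y \<partial>lborel) \<partial>M)"
    unfolding J by (rule fub(1)[symmetric])
  also have "\<dots> \<le> (\<integral>y. F y * (r + s) ^ DIM('a) \<partial>M)"
  proof (rule integral_mono)
    show "integrable M (\<lambda>y. F y * (r + s) ^ DIM('a))"
      using F by simp
    show "F y * (\<integral>t. ?G t y \<partial>lborel) \<le> F y * (r + s) ^ DIM('a)" for y
      using le F by (intro mult_left_mono)
    show "integrable M (\<lambda>y. F y * (\<integral>t. ?G t y \<partial>lborel))"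
    proof (rule Bochner_Integration.integrable_bound[OF \<open>integrable M (\<lambda>y. F y * (r + s) ^ DIM('a))\<close>])
      show "(\<lambda>y. F y * (\<integral>t. ?G t y \<partial>lborel)) \<in> borel_measurable M"
        by measurable
      have "0 \<le> (\<integral>t. ?G t y \<partial>lborel)" for y
        by (rule Bochner_Integration.integral_nonneg) simp
      then show "AE y in M. norm (F y * (\<integral>t. ?G t y \<partial>lborel)) \<le> norm (F y * (r + s) ^ DIM('a))"
        using le rs by (intro AE_I2) (auto simp: abs_mult intro!: mult_left_mono)
    qed
  qed
  finally show "(\<integral>t. J t \<partial>lborel) \<le> (r + s) ^ DIM('a) * (\<integral>y. F y \<partial>M)"
    by (simp add: mult.commute)
qed

section \<open>Counting and disjoint compact pieces for the random selection\<close>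

lemma card_subsets_separating:
  assumes "finite I" "i \<in> I" "j \<in> I" "i \<noteq> j"
  shows "card {T \<in> Pow I. j \<in> T \<and> i \<notin> T} * 4 = 2 ^ card I"
proof -
  \<comment> \<open>Such a \<open>T\<close> consists of \<open>j\<close> and an arbitrary subset of
    the elements other than \<open>i\<close> and \<open>j\<close>: two memberships are prescribed,
    hence the proportion 1/4.\<close>
  have "{T \<in> Pow I. j \<in> T \<and> i \<notin> T} = insert j ` Pow (I - {i, j})"
  proof (intro equalityI subsetI)
    fix T
    assume "T \<in> {T \<in> Pow I. j \<in> T \<and> i \<notin> T}"
    then have "T = insert j (T - {j})" "T - {j} \<in> Pow (I - {i, j})"
      by auto
    then show "T \<in> insert j ` Pow (I - {i, j})"
      by (rule image_eqI)
  qed (use assms in auto)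
  moreover have "inj_on (insert j) (Pow (I - {i, j}))"
    by (rule inj_onI) (metis Diff_insert2 Diff_insert_absorb PowD insertI1 insert_Diff insert_absorb subset_Diff_insert insert_ident)
  moreover have "card I = card (I - {i, j}) + 2"
    using assms card_Diff_subset[of "{i, j}" I] card_mono[of I "{i, j}"] by simp
  ultimately have "card {T \<in> Pow I. j \<in> T \<and> i \<notin> T} = 2 ^ card (I - {i, j})" "card I = card (I - {i, j}) + 2"
    using assms(1) by (simp_all only: card_image card_Pow finite_Diff)
  then show ?thesis
    by (simp only: power_add) simp
qed

text \<open>Making a finite ball cover disjoint destroys compactness, while restricted bounds need
  compact supports. Therefore the open complement of the earlier closed balls is exhausted by
  compact sets \<open>E i n\<close>: for each \<open>n\<close> the pieces are compact and disjoint,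
  and every point of \<open>S\<close> is eventually captured.\<close>

lemma compact_approximate_partition:
  fixes S :: "'a::euclidean_space set"
  assumes S: "compact S" and d: "0 < d"
  obtains N and P :: "nat \<Rightarrow> nat \<Rightarrow> 'a set"
  where "\<And>n i. compact (P n i)" "\<And>n i x y. x \<in> P n i \<Longrightarrow> y \<in> P n i \<Longrightarrow> norm (x - y) < d"
    "\<And>n i j. i \<noteq> j \<Longrightarrow> P n i \<inter> P n j = {}"
    "\<And>x. x \<in> S \<Longrightarrow> eventually (\<lambda>n. \<exists>i<N. x \<in> P n i) sequentially"
proof -
  \<comment> \<open>With radius \<open>d / 3\<close>, two points of one closed ball are at distance
    at most \<open>2 * d / 3\<close>, strictly below \<open>d\<close>.\<close>
  have "S \<subseteq> (\<Union>x\<in>S. ball x (d / 3))"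
    using d by auto
  then obtain F where F: "F \<subseteq> S" "finite F" "S \<subseteq> (\<Union>x\<in>F. ball x (d / 3))"
    using compactE_image[OF S, of S "\<lambda>x. ball x (d / 3)"] by auto
  obtain c and N :: nat where c: "F = c ` {i. i < N}"
    using F(2) finite_imp_nat_seg_image_inj_on by blast
  let ?B = "\<lambda>i. cball (c i) (d / 3)"
  let ?U = "\<lambda>i. - (\<Union>j<i. ?B j)"
  have U: "open (?U i)" for i
    by (intro open_Compl closed_UN) auto
  have "\<exists>E. (\<forall>n. compact (E n) \<and> E n \<subseteq> ?U i) \<and> (\<forall>x\<in>?U i. eventually (\<lambda>n. x \<in> E n) sequentially)" for i
  proof -
    obtain E where E: "\<And>n. compact (E n)" "\<And>n. E n \<subseteq> ?U i"
      "\<And>K. compact K \<Longrightarrow> K \<subseteq> ?U i \<Longrightarrow> \<exists>N::nat. \<forall>n\<ge>N. K \<subseteq> E n"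
      using open_Union_compact_subsets[OF U[of i]] by metis
    have "eventually (\<lambda>n. x \<in> E n) sequentially" if "x \<in> ?U i" for x
      using E(3)[of "{x}"] that by (simp add: eventually_sequentially)
    then show ?thesis
      using E(1,2) by blast
  qed
  then obtain E where E: "\<And>i n. compact (E i n)" "\<And>i n. E i n \<subseteq> ?U i"
    "\<And>i x. x \<in> ?U i \<Longrightarrow> eventually (\<lambda>n. x \<in> E i n) sequentially"
    by metis
  define P where "P n i = ?B i \<inter> E i n" for n i
  have disj: "P n i \<inter> P n j = {}" if "i < j" for n i j
    using E(2)[of j n] that by (auto simp: P_def)
  show thesis
  proof
    show "compact (P n i)" for n i
      unfolding P_def using E(1) by (intro compact_Int) auto
    show "norm (x - y) < d" if "x \<in> P n i" "y \<in> P n i" for n i x y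
    proof -
      have "dist (c i) x \<le> d / 3" "dist (c i) y \<le> d / 3"
        using that by (auto simp: P_def)
      then have "dist x y \<le> d / 3 + d / 3"
        using dist_triangle2[of x y "c i"] by (simp add: dist_commute)
      then show ?thesis
        using d by (simp add: dist_norm)
    qed
    show "P n i \<inter> P n j = {}" if "i \<noteq> j" for n i j
      using disj[of i j n] disj[of j i n] that by (cases i j rule: linorder_cases) auto
    fix x
    assume "x \<in> S"
    then have ex: "\<exists>i. i < N \<and> x \<in> ?B i"
      using F(3) c by (fastforce simp: less_imp_le)
    \<comment> \<open>The first ball containing \<open>x\<close>: then \<open>x\<close> avoids all
      earlier closed balls and lies in \<open>?U i\<close>.\<close>
    define i where "i = (LEAST i. i < N \<and> x \<in> ?B i)"
    have i: "i < N" "x \<in> ?B i"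
      using LeastI_ex[OF ex] by (auto simp: i_def)
    have "x \<in> ?U i"
    proof -
      have "x \<notin> ?B j" if "j < i" for j
        using not_less_Least[of j "\<lambda>i. i < N \<and> x \<in> ?B i"] that i(1) unfolding i_def by linarith
      then show ?thesis
        by blast
    qed
    then have "eventually (\<lambda>n. x \<in> E i n) sequentially"
      by (rule E(3))
    then show "eventually (\<lambda>n. \<exists>i<N. x \<in> P n i) sequentially"
      by (rule eventually_mono) (use i in \<open>auto simp: P_def\<close>)
  qed
qed

section \<open>Scaled derivative bounds\<close>

text \<open>The bound on the directional derivatives is divided by the length scale \<open>L\<close> at each order, so that
  \<open>dbound\<close> is invariant under dilation with an unchanged \<open>M\<close> (\<open>dbound_scale\<close>).\<close>

fun dbound :: "real \<Rightarrow> real \<Rightarrow> nat \<Rightarrow> ('a::euclidean_space \<Rightarrow> real) \<Rightarrow> bool" where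
  "dbound L M 0 h \<longleftrightarrow> continuous_on UNIV h \<and> (\<forall>z. \<bar>h z\<bar> \<le> M)"
| "dbound L M (Suc k) h \<longleftrightarrow> continuous_on UNIV h \<and> (\<forall>z. \<bar>h z\<bar> \<le> M) \<and>
     (\<forall>b\<in>Basis. \<exists>h'. (\<forall>z. ((\<lambda>s. h (z + s *\<^sub>R b)) has_real_derivative h' z) (at 0)) \<and> dbound L (M / L) k h')"

lemma dbound_continuous: "dbound L M k h \<Longrightarrow> continuous_on UNIV h"
  by (cases k) auto

lemma dbound_le: "dbound L M k h \<Longrightarrow> \<bar>h z\<bar> \<le> M"
  by (cases k) auto

lemma dbound_nonneg: "dbound L M k h \<Longrightarrow> 0 \<le> M"
  using dbound_le[of L M k h undefined] by linarith

lemma dbound_SucE: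
  assumes "dbound L M (Suc k) h" "b \<in> Basis"
  obtains h' where "\<And>z. ((\<lambda>s. h (z + s *\<^sub>R b)) has_real_derivative h' z) (at 0)" "dbound L (M / L) k h'"
  using assms unfolding dbound.simps by blast

lemma dbound_Suc: "dbound L M (Suc k) h \<Longrightarrow> dbound L M k h"
proof (induction k arbitrary: M h)
  case (Suc k)
  have "\<exists>h'. (\<forall>z. ((\<lambda>s. h (z + s *\<^sub>R b)) has_real_derivative h' z) (at 0)) \<and> dbound L (M / L) k h'"
    if "b \<in> Basis" for b
    using Suc.prems Suc.IH that by (subst (asm) dbound.simps) blast
  then show ?case
    using Suc.prems by auto
qed auto

lemma dbound_mono:
  assumes "0 < L" "M \<le> M'" "dbound L M k h"
  shows "dbound L M' k h"
  using assms(2,3)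
proof (induction k arbitrary: M M' h)
  case (Suc k)
  have "M / L \<le> M' / L"
    using Suc.prems \<open>0 < L\<close> by (simp add: divide_right_mono)
  have "\<exists>h'. (\<forall>z. ((\<lambda>s. h (z + s *\<^sub>R b)) has_real_derivative h' z) (at 0)) \<and> dbound L (M' / L) k h'"
    if b: "b \<in> Basis" for b
    by (rule dbound_SucE[OF Suc.prems(2) b]) (use Suc.IH[OF \<open>M / L \<le> M' / L\<close>] in blast)
  moreover have "\<bar>h z\<bar> \<le> M'" for z
    using Suc.prems dbound_le order_trans by blast
  ultimately show ?case
    using Suc.prems by auto
qed (auto intro: order_trans)

lemma dbound_shift: "dbound L M k h \<Longrightarrow> dbound L M k (\<lambda>z. h (z + a))"
proof (induction k arbitrary: M h)
  case 0
  then show ?case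
    by (auto intro!: continuous_on_compose2[of UNIV h] continuous_intros)
next
  case (Suc k)
  have "\<exists>h'. (\<forall>z. ((\<lambda>s. h (z + s *\<^sub>R b + a)) has_real_derivative h' z) (at 0)) \<and> dbound L (M / L) k h'"
    if b: "b \<in> Basis" for b
  proof -
    obtain h' where h': "\<And>z. ((\<lambda>s. h (z + s *\<^sub>R b)) has_real_derivative h' z) (at 0)" "dbound L (M / L) k h'"
      by (rule dbound_SucE[OF Suc.prems b]) (use that in blast)
    have "((\<lambda>s. h (z + s *\<^sub>R b + a)) has_real_derivative h' (z + a)) (at 0)" for z
      using h'(1)[of "z + a"] by (simp add: ac_simps)
    then show ?thesis
      using Suc.IH[OF h'(2)] by (intro exI[of _ "\<lambda>z. h' (z + a)"]) simp
  qed
  then show ?case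
    using Suc.prems by (auto intro!: continuous_on_compose2[of UNIV h] continuous_intros)
qed

lemma dbound_cmult: "dbound L M k h \<Longrightarrow> dbound L (\<bar>c\<bar> * M) k (\<lambda>z. c * h z)"
proof (induction k arbitrary: M h)
  case (Suc k)
  have "\<exists>h'. (\<forall>z. ((\<lambda>s. c * h (z + s *\<^sub>R b)) has_real_derivative h' z) (at 0)) \<and> dbound L (\<bar>c\<bar> * M / L) k h'"
    if b: "b \<in> Basis" for b
  proof -
    obtain h' where h': "\<And>z. ((\<lambda>s. h (z + s *\<^sub>R b)) has_real_derivative h' z) (at 0)" "dbound L (M / L) k h'"
      by (rule dbound_SucE[OF Suc.prems b]) (use that in blast)
    then have "dbound L (\<bar>c\<bar> * M / L) k (\<lambda>z. c * h' z)"
      using Suc.IH[OF h'(2)] by simp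
    moreover have "((\<lambda>s. c * h (z + s *\<^sub>R b)) has_real_derivative c * h' z) (at 0)" for z
      using h'(1) by (rule DERIV_cmult)
    ultimately show ?thesis
      by (intro exI[of _ "\<lambda>z. c * h' z"]) simp
  qed
  then show ?case
    using Suc.prems by (auto simp: abs_mult intro!: continuous_intros mult_left_mono)
qed (auto simp: abs_mult intro!: continuous_intros mult_left_mono)

lemma dbound_scale:
  assumes "0 < e" "dbound L M k h"
  shows "dbound (e * L) M k (\<lambda>z. h (z /\<^sub>R e))"
  using assms(2)
proof (induction k arbitrary: M h)
  case 0
  then show ?case
    by (auto intro!: continuous_on_compose2[of UNIV h] continuous_intros)
next
  case (Suc k)
  have "\<exists>h'. (\<forall>z. ((\<lambda>s. h ((z + s *\<^sub>R b) /\<^sub>R e)) has_real_derivative h' z) (at 0)) \<and> dbound (e * L) (M / (e * L)) k h'"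
    if b: "b \<in> Basis" for b
  proof -
    obtain h' where h': "\<And>z. ((\<lambda>s. h (z + s *\<^sub>R b)) has_real_derivative h' z) (at 0)" "dbound L (M / L) k h'"
      by (rule dbound_SucE[OF Suc.prems b]) (use that in blast)
    have "((\<lambda>s. h (z /\<^sub>R e + s *\<^sub>R b)) \<circ> (\<lambda>s. s / e) has_real_derivative h' (z /\<^sub>R e) * (1 / e)) (at 0)" for z
      by (rule DERIV_chain) (use h'(1)[of "z /\<^sub>R e"] \<open>0 < e\<close> in \<open>auto intro!: derivative_eq_intros\<close>)
    then have "((\<lambda>s. h ((z + s *\<^sub>R b) /\<^sub>R e)) has_real_derivative (1 / e) * h' (z /\<^sub>R e)) (at 0)" for z
      by (simp add: o_def scaleR_add_right divide_inverse mult.commute)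
    moreover have "dbound (e * L) (M / (e * L)) k (\<lambda>z. (1 / e) * h' (z /\<^sub>R e))"
      using dbound_cmult[OF Suc.IH[OF h'(2)], of "1 / e"] \<open>0 < e\<close> by (simp add: mult.commute)
    ultimately show ?thesis
      by (intro exI[of _ "\<lambda>z. (1 / e) * h' (z /\<^sub>R e)"]) blast
  qed
  then show ?case
    using Suc.prems by (auto intro!: continuous_on_compose2[of UNIV h] continuous_intros)
qed

lemma bounded_of_eventually_constant:
  fixes h :: "'a::euclidean_space \<Rightarrow> real"
  assumes "continuous_on UNIV h" "\<And>z. R < norm z \<Longrightarrow> h z = c"
  obtains M where "\<And>z. \<bar>h z\<bar> \<le> M"
proof -
  have "compact (h ` cball 0 R)"
    using assms(1) by (intro compact_continuous_image) (auto intro: continuous_on_subset)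
  then obtain b where b: "\<And>z. z \<in> cball 0 R \<Longrightarrow> \<bar>h z\<bar> \<le> b"
    by (metis compact_imp_bounded bounded_iff imageI real_norm_def)
  have "\<bar>h z\<bar> \<le> max b \<bar>c\<bar>" for z
    using b[of z] assms(2)[of z] by (cases "norm z \<le> R") auto
  then show thesis
    using that by blast
qed

text \<open>A continuous function that is constant off a ball is bounded by compactness, and its
  derivatives inherit this property with constant 0, so induction on the order applies.\<close>

lemma Ck_imp_dbound:
  fixes h :: "'a::euclidean_space \<Rightarrow> real"
  assumes "Ck k h" "\<And>z. R < norm z \<Longrightarrow> h z = c"
  shows "\<exists>M. dbound 1 M k h"
  using assms
proof (induction k arbitrary: h c)
  case 0
  have "continuous_on UNIV h"
    using 0 by simp
  then obtain M where "\<And>z. \<bar>h z\<bar> \<le> M"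
    by (rule bounded_of_eventually_constant[of h R c]) (use 0 that in auto)
  then show ?case
    using 0 by auto
next
  case (Suc k)
  obtain D where D: "\<And>x. (h has_derivative D x) (at x)" "\<And>v. Ck k (\<lambda>x. D x v)"
    using Suc.prems by auto
  have cont: "continuous_on UNIV h"
    using D(1) by (intro has_derivative_continuous_on) (auto intro: has_derivative_at_withinI)
  obtain M0 where M0: "\<And>z. \<bar>h z\<bar> \<le> M0"
    by (rule bounded_of_eventually_constant[OF cont Suc.prems(2)]) (use that in auto)
  \<comment> \<open>The set \<open>R < norm z\<close> is open and \<open>h\<close> is constant on
    it; hence the induction hypothesis is available for each directional derivative, with
    \<open>c = 0\<close>.\<close>
  have D0: "D z v = 0" if "R < norm z" for z v
  proof -
    have "open {z::'a. R < norm z}"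
      by (intro open_Collect_less continuous_intros)
    then have "(h has_derivative (\<lambda>_. 0)) (at z)"
      by (rule has_derivative_transform_within_open[OF has_derivative_const[of c]])
        (use Suc.prems(2) that in auto)
    then have "D z = (\<lambda>_. 0)"
      using D(1) has_derivative_unique by blast
    then show ?thesis
      by simp
  qed
  have "\<exists>M. dbound 1 M k (\<lambda>x. D x b)" for b
    using Suc.IH[OF D(2) D0] .
  then obtain M where M: "\<And>b. dbound 1 (M b) k (\<lambda>x. D x b)"
    by metis
  \<comment> \<open>One number dominating \<open>h\<close> and all its basis derivatives; at length
    scale 1 the bound is the same for every order.\<close>
  define N where "N = M0 + (\<Sum>b\<in>Basis. M b)"
  have M_nonneg: "0 \<le> M b" for b
    using dbound_nonneg[OF M] .
  have M0_nonneg: "0 \<le> M0"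
    using M0[of 0] by linarith
  have "((\<lambda>s. h (z + s *\<^sub>R b)) has_real_derivative D z b) (at 0)" for z b
  proof -
    have "((h \<circ> (\<lambda>s. z + s *\<^sub>R b)) has_derivative (D (z + 0 *\<^sub>R b) \<circ> (\<lambda>s. s *\<^sub>R b))) (at 0)"
      by (rule diff_chain_at) (use D(1) in \<open>auto intro!: derivative_eq_intros\<close>)
    moreover have "D z (s *\<^sub>R b) = D z b * s" for s
      using linear_cmul[OF has_derivative_linear[OF D(1)], of z s b] by (simp add: mult.commute)
    ultimately show ?thesis
      by (simp add: has_field_derivative_def o_def)
  qed
  moreover have "dbound 1 N k (\<lambda>x. D x b)" if "b \<in> Basis" for b
  proof (rule dbound_mono[OF _ _ M])
    show "M b \<le> N"
      unfolding N_def using member_le_sum[OF that, of M] M_nonneg M0_nonneg by simp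
  qed simp
  moreover have "\<bar>h z\<bar> \<le> N" for z
    using M0[of z] sum_nonneg[of Basis M] M_nonneg unfolding N_def by (simp add: add_increasing2)
  ultimately have "dbound 1 N (Suc k) h"
    unfolding dbound.simps div_by_1 using cont by (intro conjI allI ballI exI) assumption+
  then show ?case ..
qed

section \<open>Multipliers of a restrictedly bounded kernel\<close>

text \<open>The restricted bound is stated with a nonnegative constant and the norms
  \<open>lpn\<close>, so that all estimates can be carried out in the reals.\<close>

locale restricted_kernel =
  fixes \<mu> \<nu> :: "'a::euclidean_space measure" and p q C :: real and K :: "'a \<Rightarrow> 'a \<Rightarrow> real"
  assumes radon_\<mu>: "radon \<mu>" and radon_\<nu>: "radon \<nu>"
    and p_gt_1: "1 < p" and q_eq: "q = p / (p - 1)"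
    and K_measurable: "(\<lambda>(x, y). K x y) \<in> borel_measurable (\<nu> \<Otimes>\<^sub>M \<mu>)"
    and K_L2loc: "L2loc_offdiag \<mu> \<nu> K"
    and C_nonneg: "0 \<le> C"
    and restricted: "\<And>A B f g. compact A \<Longrightarrow> compact B \<Longrightarrow> A \<inter> B = {} \<Longrightarrow> bsupp A f \<Longrightarrow> bsupp B g
      \<Longrightarrow> \<bar>\<integral>x. (\<integral>y. K x y * f y \<partial>\<mu>) * g x \<partial>\<nu>\<bar> \<le> C * lpn \<mu> p f * lpn \<nu> q g"
begin

sublocale pair_sigma_finite \<nu> \<mu>
  using radon_\<mu> radon_\<nu> by (simp add: pair_sigma_finite_def radon_sigma_finite)

lemma sets_borel [measurable_cong, simp]: "sets \<mu> = sets borel" "sets \<nu> = sets borel"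
  using radon_\<mu> radon_\<nu> by (auto simp: radon_sets)

lemma sets_pair_borel: "sets (\<nu> \<Otimes>\<^sub>M \<mu>) = sets (borel :: ('a \<times> 'a) measure)"
  by (metis borel_prod sets_borel sets_pair_measure_cong)

lemma space_UNIV [simp]: "space \<mu> = UNIV" "space \<nu> = UNIV"
  by (metis sets_borel sets_eq_imp_space_eq space_borel)+

lemma K_meas [measurable]: "(\<lambda>z. K (fst z) (snd z)) \<in> borel_measurable (\<nu> \<Otimes>\<^sub>M \<mu>)"
  using K_measurable by (simp add: case_prod_beta')

lemma p_q: "0 < p" "1 < q" "0 < q" "1 / p + 1 / q = 1" "(p - 1) * q = p"
  using p_gt_1 by (auto simp: q_eq field_simps)

section \<open>Absolute convergence of the bilinear form away from the diagonal\<close>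

lemma emeasure_compact_pair:
  assumes "compact D"
  shows "emeasure (\<nu> \<Otimes>\<^sub>M \<mu>) D < \<infinity>"
proof -
  have c: "compact (fst ` D)" "compact (snd ` D)"
    using assms by (auto intro!: compact_continuous_image continuous_intros)
  have "emeasure (\<nu> \<Otimes>\<^sub>M \<mu>) D \<le> emeasure (\<nu> \<Otimes>\<^sub>M \<mu>) (fst ` D \<times> snd ` D)"
  proof (rule emeasure_mono)
    show "D \<subseteq> fst ` D \<times> snd ` D"
      by (rule subset_fst_snd)
    show "fst ` D \<times> snd ` D \<in> sets (\<nu> \<Otimes>\<^sub>M \<mu>)"
      using c by (intro pair_measureI) (auto intro: borel_compact)
  qed
  also have "\<dots> = emeasure \<nu> (fst ` D) * emeasure \<mu> (snd ` D)"
    using c by (intro M2.emeasure_pair_measure_Times) (auto intro: borel_compact)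
  also have "\<dots> < \<infinity>"
    using c radon_finite_on_compact[OF radon_\<mu>] radon_finite_on_compact[OF radon_\<nu>]
    by (simp add: ennreal_mult_less_top)
  finally show ?thesis .
qed

text \<open>Finitely many neighbourhoods on which \<open>K\<close> is square integrable cover
  \<open>D\<close>. Since \<open>D\<close> has finite measure, the inequality 2 |K| \<le> 1 + K^2
  turns square integrability into integrability.\<close>

lemma K_integrable_off_diagonal:
  assumes D: "compact D" "\<And>x. (x, x) \<notin> D"
  shows "integrable (\<nu> \<Otimes>\<^sub>M \<mu>) (\<lambda>z. indicator D z * K (fst z) (snd z))"
proof -
  have Dm[measurable]: "D \<in> sets (\<nu> \<Otimes>\<^sub>M \<mu>)"
    unfolding sets_pair_borel using D(1) by (rule borel_compact)
  define good where "good G z \<longleftrightarrow> open G \<and> z \<in> G \<and>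
        (\<integral>\<^sup>+ w. ennreal ((indicator G w * K (fst w) (snd w))\<^sup>2) \<partial>(\<nu> \<Otimes>\<^sub>M \<mu>)) < \<infinity>" for G z
  have "\<exists>G. good G z" if "z \<in> D" for z
  proof -
    have "fst z \<noteq> snd z"
      using that D(2) by (metis prod.collapse)
    then show ?thesis
      using K_L2loc[unfolded L2loc_offdiag_def, rule_format, of "fst z" "snd z"] by (simp add: good_def)
  qed
  then obtain G where "\<And>z. z \<in> D \<Longrightarrow> good (G z) z"
    by metis
  then have G: "\<And>z. z \<in> D \<Longrightarrow> open (G z)" "\<And>z. z \<in> D \<Longrightarrow> z \<in> G z"
    "\<And>z. z \<in> D \<Longrightarrow> (\<integral>\<^sup>+ w. ennreal ((indicator (G z) w * K (fst w) (snd w))\<^sup>2) \<partial>(\<nu> \<Otimes>\<^sub>M \<mu>)) < \<infinity>"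
    by (auto simp: good_def)
  obtain F where F: "F \<subseteq> D" "finite F" "D \<subseteq> (\<Union>z\<in>F. G z)"
    using compactE_image[OF D(1), of D G] G by blast
  have bound: "norm (indicator D w * K (fst w) (snd w))
     \<le> (\<Sum>z\<in>F. indicator D w + (indicator (G z) w * K (fst w) (snd w))\<^sup>2)" for w
  proof (cases "w \<in> D")
    case True
    then obtain z where z: "z \<in> F" "w \<in> G z"
      using F by auto
    have "2 * \<bar>K (fst w) (snd w)\<bar> \<le> 1 + (K (fst w) (snd w))\<^sup>2"
      using sum_squares_bound[of 1 "\<bar>K (fst w) (snd w)\<bar>"] by simp
    then have "norm (indicator D w * K (fst w) (snd w))
      \<le> indicator D w + (indicator (G z) w * K (fst w) (snd w))\<^sup>2"
      using True z by simp
    also have "\<dots> \<le> (\<Sum>z\<in>F. indicator D w + (indicator (G z) w * K (fst w) (snd w))\<^sup>2)"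
      using F z by (intro member_le_sum) auto
    finally show ?thesis .
  qed (auto intro!: sum_nonneg)
  have "integrable (\<nu> \<Otimes>\<^sub>M \<mu>) (\<lambda>w. \<Sum>z\<in>F. indicator D w + (indicator (G z) w * K (fst w) (snd w))\<^sup>2)"
  proof (intro Bochner_Integration.integrable_sum Bochner_Integration.integrable_add)
    show "integrable (\<nu> \<Otimes>\<^sub>M \<mu>) (\<lambda>w. indicator D w :: real)"
      by (rule integrable_real_indicator[OF _ emeasure_compact_pair[OF D(1)]]) (rule Dm)
    show "integrable (\<nu> \<Otimes>\<^sub>M \<mu>) (\<lambda>w. (indicator (G z) w * K (fst w) (snd w))\<^sup>2)" if "z \<in> F" for z
    proof (rule integrableI_bounded)
      have [measurable]: "G z \<in> sets (\<nu> \<Otimes>\<^sub>M \<mu>)"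
        unfolding sets_pair_borel by (rule borel_open, rule G(1), rule subsetD[OF F(1) that])
      show "(\<lambda>w. (indicator (G z) w * K (fst w) (snd w))\<^sup>2) \<in> borel_measurable (\<nu> \<Otimes>\<^sub>M \<mu>)"
        by measurable
      show "(\<integral>\<^sup>+ w. ennreal (norm ((indicator (G z) w * K (fst w) (snd w))\<^sup>2)) \<partial>(\<nu> \<Otimes>\<^sub>M \<mu>)) < \<infinity>"
        unfolding real_norm_def abs_power2 by (rule G(3)[OF subsetD[OF F(1) that]])
    qed
  qed
  then show ?thesis
  proof (rule Bochner_Integration.integrable_bound)
    show "(\<lambda>w. indicator D w * K (fst w) (snd w)) \<in> borel_measurable (\<nu> \<Otimes>\<^sub>M \<mu>)"
      by measurable
  qed (intro AE_I2 order_trans[OF bound], simp only: real_norm_def abs_ge_self)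
qed

text \<open>The integrand lives on the compact set \<open>(B \<times> A) \<inter> D\<close>, which
  misses the diagonal, and the factors other than \<open>K\<close> are bounded. The set
  \<open>D\<close> covers two situations: separated supports (\<open>D = B \<times> A\<close>) and
  weights vanishing near the diagonal.\<close>

lemma form_integrable:
  assumes "compact A" "compact B" "bsupp A f" "bsupp B g"
    and w[measurable]: "w \<in> borel_measurable (\<nu> \<Otimes>\<^sub>M \<mu>)" and w_bound: "\<And>z. \<bar>w z\<bar> \<le> M"
    and D: "closed D" "\<And>x. (x, x) \<notin> D" "\<And>z. z \<notin> D \<Longrightarrow> fst z \<in> B \<Longrightarrow> snd z \<in> A \<Longrightarrow> w z = 0"
  shows "integrable (\<nu> \<Otimes>\<^sub>M \<mu>) (\<lambda>z. K (fst z) (snd z) * f (snd z) * g (fst z) * w z)"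
proof -
  have [measurable]: "f \<in> borel_measurable borel" "g \<in> borel_measurable borel"
    using assms by (auto simp: bsupp_def)
  obtain a b where ab: "\<And>x. \<bar>f x\<bar> \<le> a" "\<And>x. \<bar>g x\<bar> \<le> b"
    using assms by (auto simp: bsupp_def bounded_iff)
  define E where "E = (B \<times> A) \<inter> D"
  have "compact E"
    unfolding E_def using assms by (intro compact_Int_closed compact_Times)
  then have I: "integrable (\<nu> \<Otimes>\<^sub>M \<mu>) (\<lambda>z. a * b * M * (indicator E z * K (fst z) (snd z)))"
    using D by (intro integrable_mult_right K_integrable_off_diagonal) (auto simp: E_def)
  have nonneg: "0 \<le> a" "0 \<le> b" "0 \<le> M"
    using ab[of 0] w_bound[of 0] by linarith+
  have "\<bar>K (fst z) (snd z) * f (snd z) * g (fst z) * w z\<bar> \<le> \<bar>a * b * M * (indicator E z * K (fst z) (snd z))\<bar>" for z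
  proof (cases "z \<in> E")
    case True
    have "\<bar>f (snd z)\<bar> * \<bar>g (fst z)\<bar> * \<bar>w z\<bar> \<le> a * b * M"
      using ab w_bound nonneg by (intro mult_mono) auto
    then have "\<bar>K (fst z) (snd z)\<bar> * (\<bar>f (snd z)\<bar> * \<bar>g (fst z)\<bar> * \<bar>w z\<bar>) \<le> \<bar>K (fst z) (snd z)\<bar> * (a * b * M)"
      by (rule mult_left_mono) simp
    then show ?thesis
      using True nonneg by (simp add: abs_mult ac_simps)
  next
    case False
    then have "f (snd z) * g (fst z) * w z = 0"
      using assms(3,4) D(3)[of z] by (cases "z \<in> D") (auto simp: E_def bsupp_def mem_Times_iff)
    then have "K (fst z) (snd z) * f (snd z) * g (fst z) * w z = 0"
      by auto
    then show ?thesis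
      by (simp only: abs_zero abs_ge_zero)
  qed
  then show ?thesis
    by (intro Bochner_Integration.integrable_bound[OF I]) auto
qed

lemma separated_form_integrable:
  assumes "compact A" "compact B" "A \<inter> B = {}" "bsupp A f" "bsupp B g"
    and w: "w \<in> borel_measurable (\<nu> \<Otimes>\<^sub>M \<mu>)" "\<And>z. \<bar>w z\<bar> \<le> M"
  shows "integrable (\<nu> \<Otimes>\<^sub>M \<mu>) (\<lambda>z. K (fst z) (snd z) * f (snd z) * g (fst z) * w z)"
  by (rule form_integrable[where D = "B \<times> A"])
    (use assms in \<open>auto intro: closed_Times compact_imp_closed simp: mem_Times_iff\<close>)

section \<open>Weighted bilinear forms and the algebra of multipliers\<close>

definition form :: "('a \<times> 'a \<Rightarrow> real) \<Rightarrow> ('a \<Rightarrow> real) \<Rightarrow> ('a \<Rightarrow> real) \<Rightarrow> real" where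
  "form w f g = (\<integral>z. K (fst z) (snd z) * f (snd z) * g (fst z) * w z \<partial>(\<nu> \<Otimes>\<^sub>M \<mu>))"

text \<open>\<open>D\<close> bounds the restricted norm of the weighted kernel \<open>K w\<close>,
  so the constant \<open>C\<close> of \<open>K\<close> itself is already contained in it.
  Boundedness of \<open>w\<close> makes the forms converge.\<close>

definition multiplier :: "('a \<times> 'a \<Rightarrow> real) \<Rightarrow> real \<Rightarrow> bool" where
  "multiplier w D \<longleftrightarrow> w \<in> borel_measurable (\<nu> \<Otimes>\<^sub>M \<mu>) \<and> bounded (range w) \<and> 0 \<le> D \<and>
     (\<forall>A B f g. compact A \<longrightarrow> compact B \<longrightarrow> A \<inter> B = {} \<longrightarrow> bsupp A f \<longrightarrow> bsupp B g
       \<longrightarrow> \<bar>form w f g\<bar> \<le> D * lpn \<mu> p f * lpn \<nu> q g)"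

lemma multiplierD:
  assumes "multiplier w D"
  shows "w \<in> borel_measurable (\<nu> \<Otimes>\<^sub>M \<mu>)" "bounded (range w)" "0 \<le> D"
    and "\<And>A B f g. compact A \<Longrightarrow> compact B \<Longrightarrow> A \<inter> B = {} \<Longrightarrow> bsupp A f \<Longrightarrow> bsupp B g
       \<Longrightarrow> \<bar>form w f g\<bar> \<le> D * lpn \<mu> p f * lpn \<nu> q g"
  using assms unfolding multiplier_def by blast+

lemma multiplierI:
  assumes "w \<in> borel_measurable (\<nu> \<Otimes>\<^sub>M \<mu>)" "\<And>z. \<bar>w z\<bar> \<le> M" "0 \<le> D"
    and "\<And>A B f g. compact A \<Longrightarrow> compact B \<Longrightarrow> A \<inter> B = {} \<Longrightarrow> bsupp A f \<Longrightarrow> bsupp B g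
      \<Longrightarrow> \<bar>form w f g\<bar> \<le> D * lpn \<mu> p f * lpn \<nu> q g"
  shows "multiplier w D"
  unfolding multiplier_def using assms(1,3,4) bounded_range_abs[of w M, OF assms(2)]
  by (intro conjI allI impI) assumption+

lemma multiplier_one: "multiplier (\<lambda>_. 1) C"
proof -
  have "\<bar>form (\<lambda>_. 1) f g\<bar> \<le> C * lpn \<mu> p f * lpn \<nu> q g"
    if "compact A" "compact B" "A \<inter> B = {}" "bsupp A f" "bsupp B g" for A B f g
  proof -
    have "integrable (\<nu> \<Otimes>\<^sub>M \<mu>) (\<lambda>z. K (fst z) (snd z) * f (snd z) * g (fst z) * 1)"
      by (rule separated_form_integrable[OF that, where M = 1]) auto
    from integral_fst'[OF this] show ?thesis
      using restricted[OF that] by (simp add: form_def mult.assoc[symmetric])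
  qed
  then show ?thesis
    using C_nonneg by (auto simp: multiplier_def)
qed

text \<open>The factors are absorbed into the test functions: \<open>u\<close> goes into
  \<open>g\<close> and \<open>v\<close> into \<open>f\<close>, which leaves supports separated and
  changes the norms by at most 1 and \<open>M\<close>.\<close>

lemma multiplier_product:
  assumes w: "multiplier w D"
    and u: "u \<in> borel_measurable borel" "\<And>x. \<bar>u x\<bar> \<le> 1"
    and v: "v \<in> borel_measurable borel" "\<And>y. \<bar>v y\<bar> \<le> M"
  shows "multiplier (\<lambda>z. u (fst z) * v (snd z) * w z) (M * D)"
proof -
  have M: "0 \<le> M"
    using v(2)[of 0] by linarith
  obtain a where a: "\<And>z. \<bar>w z\<bar> \<le> a"
    using multiplierD(2)[OF w] by (auto simp: bounded_iff)
  have [measurable]: "w \<in> borel_measurable (\<nu> \<Otimes>\<^sub>M \<mu>)"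
    by (rule multiplierD[OF w])
  have "\<bar>form (\<lambda>z. u (fst z) * v (snd z) * w z) f g\<bar> \<le> (M * D) * lpn \<mu> p f * lpn \<nu> q g"
    if AB: "compact A" "compact B" "A \<inter> B = {}" "bsupp A f" "bsupp B g" for A B f g
  proof -
    have f: "bsupp A (\<lambda>y. v y * f y)" and g: "bsupp B (\<lambda>x. u x * g x)"
      using AB u v by (auto intro: bsupp_times)
    have "lpn \<mu> p (\<lambda>y. v y * f y) \<le> lpn \<mu> p (\<lambda>y. M * f y)"
      using v(2) M by (intro lpn_mono[OF radon_\<mu> AB(1) p_q(1) f bsupp_cmult[OF AB(4)]])
        (auto simp: abs_mult intro!: mult_right_mono)
    then have "lpn \<mu> p (\<lambda>y. v y * f y) \<le> M * lpn \<mu> p f"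
      by (simp add: lpn_cmult M p_q)
    moreover have "lpn \<nu> q (\<lambda>x. u x * g x) \<le> lpn \<nu> q g"
      using u(2) by (intro lpn_mono[OF radon_\<nu> AB(2) p_q(3) g AB(5)]) (auto simp: abs_mult mult_left_le_one_le)
    ultimately have le: "D * lpn \<mu> p (\<lambda>y. v y * f y) * lpn \<nu> q (\<lambda>x. u x * g x) \<le> D * (M * lpn \<mu> p f) * lpn \<nu> q g"
      using multiplierD(3)[OF w] M by (intro mult_mono) (auto intro!: mult_nonneg_nonneg lpn_nonneg)
    have "form (\<lambda>z. u (fst z) * v (snd z) * w z) f g = form w (\<lambda>y. v y * f y) (\<lambda>x. u x * g x)"
      by (simp add: form_def ac_simps)
    then show ?thesis
      using multiplierD(4)[OF w AB(1-3) f g] le by (simp add: ac_simps)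
  qed
  moreover have "\<bar>u (fst z) * v (snd z) * w z\<bar> \<le> 1 * M * a" for z
    unfolding abs_mult using u(2) v(2) a M by (intro mult_mono) auto
  then have "bounded (range (\<lambda>z. u (fst z) * v (snd z) * w z))"
    by (rule bounded_range_abs)
  ultimately show ?thesis
    using multiplierD(3)[OF w] M u v by (auto simp: multiplier_def)
qed

lemma multiplier_add:
  assumes w: "multiplier w D" and w': "multiplier w' D'"
  shows "multiplier (\<lambda>z. w z + c * w' z) (D + \<bar>c\<bar> * D')"
proof -
  obtain a where a: "\<And>z. \<bar>w z\<bar> \<le> a"
    using multiplierD(2)[OF w] by (auto simp: bounded_iff)
  obtain a' where a': "\<And>z. \<bar>w' z\<bar> \<le> a'"
    using multiplierD(2)[OF w'] by (auto simp: bounded_iff)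
  have "\<bar>form (\<lambda>z. w z + c * w' z) f g\<bar> \<le> (D + \<bar>c\<bar> * D') * lpn \<mu> p f * lpn \<nu> q g"
    if AB: "compact A" "compact B" "A \<inter> B = {}" "bsupp A f" "bsupp B g" for A B f g
  proof -
    have "form (\<lambda>z. w z + c * w' z) f g = form w f g + c * form w' f g"
      unfolding form_def using separated_form_integrable[OF AB multiplierD(1)[OF w] a]
        separated_form_integrable[OF AB multiplierD(1)[OF w'] a']
      by (simp add: distrib_left mult.left_commute[of _ c])
    also have "\<bar>\<dots>\<bar> \<le> \<bar>form w f g\<bar> + \<bar>c\<bar> * \<bar>form w' f g\<bar>"
      by (metis abs_mult abs_triangle_ineq)
    also have "\<dots> \<le> D * lpn \<mu> p f * lpn \<nu> q g + \<bar>c\<bar> * (D' * lpn \<mu> p f * lpn \<nu> q g)"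
      using multiplierD(4)[OF w AB] multiplierD(4)[OF w' AB] by (intro add_mono mult_left_mono) auto
    finally show ?thesis
      by (simp add: algebra_simps)
  qed
  moreover have "\<bar>w z + c * w' z\<bar> \<le> a + \<bar>c\<bar> * a'" for z
    using a[of z] a'[of z] by (intro order_trans[OF abs_triangle_ineq] add_mono) (auto simp: abs_mult intro!: mult_left_mono)
  then have "bounded (range (\<lambda>z. w z + c * w' z))"
    by (rule bounded_range_abs)
  ultimately show ?thesis
    using multiplierD(1,3)[OF w] multiplierD(1,3)[OF w'] by (auto simp: multiplier_def)
qed

text \<open>The superposition principle that replaces Fourier inversion.\<close>

lemma multiplier_integral:
  fixes G :: "real \<Rightarrow> 'a \<times> 'a \<Rightarrow> real"
  assumes G: "\<And>s. s \<in> {0..L} \<Longrightarrow> multiplier (G s) D" and "0 \<le> D" "0 \<le> L"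
    and G_meas[measurable]: "case_prod G \<in> borel_measurable (lborel \<Otimes>\<^sub>M (\<nu> \<Otimes>\<^sub>M \<mu>))"
    and M: "\<And>s z. \<bar>G s z\<bar> \<le> M"
  shows "multiplier (\<lambda>z. \<integral>s. indicator {0..L} s * G s z \<partial>lborel) (L * D)"
proof -
  have GH: "\<bar>indicator {0..L} s * G s z\<bar> \<le> M * indicator {0..L} s" for s z
    using M[of s z] by (auto simp: indicator_def)
  have int: "integrable lborel (\<lambda>s. M * indicator {0..L} s :: real)"
    by (intro integrable_mult_right integrable_real_indicator) (auto simp: emeasure_lborel_Icc_eq)
  have "\<bar>form (\<lambda>z. \<integral>s. indicator {0..L} s * G s z \<partial>lborel) f g\<bar> \<le> (L * D) * lpn \<mu> p f * lpn \<nu> q g"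
    if AB: "compact A" "compact B" "A \<inter> B = {}" "bsupp A f" "bsupp B g" for A B f g
  proof -
    let ?W = "\<lambda>z. K (fst z) (snd z) * f (snd z) * g (fst z)"
    let ?D = "D * lpn \<mu> p f * lpn \<nu> q g"
    have W: "integrable (\<nu> \<Otimes>\<^sub>M \<mu>) ?W"
      using separated_form_integrable[OF AB, of "\<lambda>_. 1" 1] by simp
    have sf: "sigma_finite_measure (lborel :: real measure)" "sigma_finite_measure (\<nu> \<Otimes>\<^sub>M \<mu>)"
      by (auto intro: sigma_finite_lborel simp: sigma_finite_measure_axioms)
    \<comment> \<open>Fubini turns the form of the superposition into the integral over
      \<open>s\<close> of the forms of \<open>G s\<close>; each is at most \<open>?D\<close> in
      absolute value, and the interval has length \<open>L\<close>.\<close>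
    note F = fubini_parameter[OF sf int W _ GH]
    have Gm: "(\<lambda>(s, z). indicator {0..L} s * G s z) \<in> borel_measurable (lborel \<Otimes>\<^sub>M (\<nu> \<Otimes>\<^sub>M \<mu>))"
      by measurable
    have eq: "(\<integral>z. ?W z * (indicator {0..L} s * G s z) \<partial>(\<nu> \<Otimes>\<^sub>M \<mu>)) = indicator {0..L} s * form (G s) f g" for s
      by (simp add: form_def mult.left_commute[of _ "indicator {0..L} s"])
    have "\<bar>\<integral>s. indicator {0..L} s * form (G s) f g \<partial>lborel\<bar>
        \<le> (\<integral>s. \<bar>indicator {0..L} s * form (G s) f g\<bar> \<partial>lborel)"
      by (rule integral_abs_bound)
    also have "\<dots> \<le> (\<integral>s. ?D * indicator {0..L} s \<partial>lborel)"
    proof (rule integral_mono)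
      show "integrable lborel (\<lambda>s. \<bar>indicator {0..L} s * form (G s) f g\<bar>)"
        using F(2)[OF Gm] unfolding eq by (rule integrable_abs)
      show "\<bar>indicator {0..L} s * form (G s) f g\<bar> \<le> ?D * indicator {0..L} s" for s
        using multiplierD(4)[OF G AB] by (auto simp: indicator_def)
      show "integrable lborel (\<lambda>s. ?D * indicator {0..L} s)"
        by (intro integrable_mult_right integrable_real_indicator) (auto simp: emeasure_lborel_Icc_eq)
    qed
    also have "\<dots> = L * ?D"
      using \<open>0 \<le> L\<close> by simp
    finally show ?thesis
      using F(1)[OF Gm] unfolding eq by (simp only: form_def mult.assoc)
  qed
  moreover have "\<bar>\<integral>s. indicator {0..L} s * G s z \<partial>lborel\<bar> \<le> (\<integral>s. M * indicator {0..L} s \<partial>lborel)" for z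
  proof -
    have [measurable]: "(\<lambda>s. G s z) \<in> borel_measurable lborel"
      using measurable_Pair1[OF G_meas, of z] by (simp add: space_pair_measure)
    have "(\<integral>s. \<bar>indicator {0..L} s * G s z\<bar> \<partial>lborel) \<le> (\<integral>s. M * indicator {0..L} s \<partial>lborel)"
    proof (intro integral_mono integrable_abs int GH)
      show "integrable lborel (\<lambda>s. indicator {0..L} s * G s z)"
        by (rule Bochner_Integration.integrable_bound[OF int])
          (measurable, intro AE_I2, simp only: real_norm_def order_trans[OF GH abs_ge_self])
    qed
    then show ?thesis
      by (rule order_trans[OF integral_abs_bound])
  qed
  then have "bounded (range (\<lambda>z. \<integral>s. indicator {0..L} s * G s z \<partial>lborel))"
    by (rule bounded_range_abs)
  moreover have "(\<lambda>z. \<integral>s. indicator {0..L} s * G s z \<partial>lborel) \<in> borel_measurable (\<nu> \<Otimes>\<^sub>M \<mu>)"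
    by (intro lborel.borel_measurable_lebesgue_integral) measurable
  ultimately show ?thesis
    using assms(2,3) by (auto simp: multiplier_def)
qed

text \<open>For \<open>S\<close> inside \<open>Basis\<close> this point has the coordinates of
  \<open>x\<close> along \<open>S\<close> and those of \<open>c\<close> elsewhere; it moves from
  \<open>c\<close> to \<open>x\<close> one coordinate at a time.\<close>

definition coord_proj :: "'a set \<Rightarrow> 'a \<Rightarrow> 'a \<Rightarrow> 'a" where
  "coord_proj S c x = c + (\<Sum>b\<in>S. ((x - c) \<bullet> b) *\<^sub>R b)"

lemma coord_proj_Basis: "coord_proj Basis c x = x"
  by (simp add: coord_proj_def euclidean_representation)

lemma coord_proj_measurable [measurable]: "coord_proj S c \<in> borel_measurable borel"
  unfolding coord_proj_def by measurable

text \<open>Passing from \<open>S\<close> to \<open>insert b S\<close> replaces the constant \<open>b\<close>-coordinate of \<open>c\<close> by that of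
  \<open>x\<close>. By the fundamental theorem of calculus the difference is an integral over \<open>s\<close> of the indicator of
  \<open>s \<le> (x - c) \<bullet> b\<close>, which depends on \<open>x\<close> only, times a translate of the derivative of \<open>h\<close> in
  direction \<open>b\<close>, to which the induction hypothesis applies.\<close>

lemma multiplier_on_cube:
  assumes L: "0 < L" and "finite S" "S \<subseteq> Basis" "dbound L M (card S) h"
  shows "multiplier (\<lambda>z. h (coord_proj S c (fst z) - snd z) * indicator (cbox c (c + L *\<^sub>R One)) (fst z))
    (2 ^ card S * M * C)"
  using assms(2-)
proof (induction S arbitrary: M h rule: finite_induct)
  case empty
  have [measurable]: "h \<in> borel_measurable borel"
    using empty dbound_continuous by (intro borel_measurable_continuous_onI) blast
  \<comment> \<open>With no coordinate of \<open>x\<close> left in the argument, the weight is a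
    function of \<open>x\<close> times a function of \<open>y\<close>.\<close>
  have "multiplier (\<lambda>z. indicator (cbox c (c + L *\<^sub>R One)) (fst z) * h (c - snd z) * 1) (M * C)"
    by (rule multiplier_product[OF multiplier_one]) (use dbound_le[OF empty(2)] in \<open>auto simp: indicator_def\<close>)
  then show ?case
    by (simp add: coord_proj_def mult.commute)
next
  case (insert b S)
  let ?k = "card S" and ?Q = "cbox c (c + L *\<^sub>R One)"
  have b: "b \<in> Basis" and S: "S \<subseteq> Basis" and h: "dbound L M (Suc ?k) h"
    using insert by auto
  obtain h' where h': "\<And>z. ((\<lambda>s. h (z + s *\<^sub>R b)) has_real_derivative h' z) (at 0)" "dbound L (M / L) ?k h'"
    by (rule dbound_SucE[OF h b]) (use that in blast)
  have h'_cont: "continuous_on UNIV h'"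
    using h'(2) by (rule dbound_continuous)
  have [measurable]: "h' \<in> borel_measurable borel"
    using h'_cont by (rule borel_measurable_continuous_onI)
  define w where "w = (\<lambda>s z. h' (coord_proj S c (fst z) - snd z + s *\<^sub>R b) * indicator ?Q (fst z))"
  define u where "u = (\<lambda>s x. if s \<le> (x - c) \<bullet> b then 1 else 0 :: real)"
  have "multiplier (w s) (2 ^ ?k * (M / L) * C)" for s
    using insert.IH[OF S dbound_shift[OF h'(2), of "s *\<^sub>R b"]] by (simp add: w_def)
  then have "multiplier (\<lambda>z. u s (fst z) * 1 * w s z) (1 * (2 ^ ?k * (M / L) * C))" for s
    by (rule multiplier_product) (auto simp: u_def)
  then have "multiplier (\<lambda>z. \<integral>s. indicator {0..L} s * (u s (fst z) * 1 * w s z) \<partial>lborel)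
      (L * (1 * (2 ^ ?k * (M / L) * C)))"
  proof (rule multiplier_integral)
    show "0 \<le> 1 * (2 ^ ?k * (M / L) * C)" "0 \<le> L"
      using dbound_nonneg[OF h'(2)] C_nonneg L by (simp_all only: mult_1 mult_nonneg_nonneg zero_le_power zero_le_numeral less_imp_le)
    show "(\<lambda>(s, z). u s (fst z) * 1 * w s z) \<in> borel_measurable (lborel \<Otimes>\<^sub>M (\<nu> \<Otimes>\<^sub>M \<mu>))"
      unfolding u_def w_def by measurable
    show "\<bar>u s (fst z) * 1 * w s z\<bar> \<le> M / L" for s z
      using dbound_le[OF h'(2)] dbound_nonneg[OF h'(2)] by (auto simp: u_def w_def indicator_def)
  qed
  then have mult: "multiplier (\<lambda>z. h (coord_proj S c (fst z) - snd z) * indicator ?Q (fst z)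
      + 1 * (\<integral>s. indicator {0..L} s * (u s (fst z) * 1 * w s z) \<partial>lborel))
      (2 ^ ?k * M * C + \<bar>1\<bar> * (L * (1 * (2 ^ ?k * (M / L) * C))))"
    by (rule multiplier_add[OF insert.IH[OF S dbound_Suc[OF h]]])
  have eq: "h (coord_proj S c x - y) * indicator ?Q x
      + 1 * (\<integral>s. indicator {0..L} s * (u s x * 1 * w s (x, y)) \<partial>lborel)
      = h (coord_proj (insert b S) c x - y) * indicator ?Q x" for x y
  proof (cases "x \<in> ?Q")
    case True
    define t where "t = (x - c) \<bullet> b"
    have t: "0 \<le> t" "t \<le> L"
      using True b by (auto simp: t_def mem_box inner_diff_left inner_add_left)
    define v where "v = coord_proj S c x - y"
    have "coord_proj (insert b S) c x - y = v + t *\<^sub>R b"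
      using insert by (simp add: coord_proj_def v_def t_def)
    moreover have "(\<integral>s. h' (v + s *\<^sub>R b) * indicator {0..t} s \<partial>lborel) = h (v + t *\<^sub>R b) - h (v + 0 *\<^sub>R b)"
    proof (rule integral_FTC_Icc_real)
      show "((\<lambda>s. h (v + s *\<^sub>R b)) has_real_derivative h' (v + s *\<^sub>R b)) (at s)" for s
        using h'(1)[of "v + s *\<^sub>R b"] DERIV_shift[of "\<lambda>s. h (v + s *\<^sub>R b)" _ 0 s]
        by (simp add: scaleR_add_left ac_simps)
      show "isCont (\<lambda>s. h' (v + s *\<^sub>R b)) s" for s
        using continuous_on_compose2[OF h'_cont, of UNIV "\<lambda>s. v + s *\<^sub>R b"]
        by (auto simp: continuous_on_eq_continuous_at intro!: continuous_intros)
    qed fact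
    \<comment> \<open>The superposition must run over the fixed interval \<open>{0..L}\<close>;
      since \<open>t \<le> L\<close> on the cube, the cutoff \<open>u\<close> shortens it to the
      interval \<open>{0..t}\<close> of the fundamental theorem.\<close>
    moreover have "indicator {0..L} s * (u s x * 1 * w s (x, y)) = h' (v + s *\<^sub>R b) * indicator {0..t} s" for s
      using True t by (auto simp: u_def w_def v_def t_def indicator_def)
    ultimately show ?thesis
      using True by (simp add: v_def diff_add_eq)
  qed (simp add: w_def)
  have "h (coord_proj S c (fst z) - snd z) * indicator ?Q (fst z)
      + 1 * (\<integral>s. indicator {0..L} s * (u s (fst z) * 1 * w s z) \<partial>lborel)
      = h (coord_proj (insert b S) c (fst z) - snd z) * indicator ?Q (fst z)" for z
    using eq[of "fst z" "snd z"] by (simp only: prod.collapse)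
  \<comment> \<open>The derivative bound \<open>M / L\<close> times the length \<open>L\<close>
    gives back \<open>M\<close>, so each coordinate just doubles the constant, independently of the
    scale.\<close>
  moreover have "2 ^ ?k * M * C + \<bar>1\<bar> * (L * (1 * (2 ^ ?k * (M / L) * C))) = 2 ^ card (insert b S) * M * C"
    using L insert by simp
  ultimately show ?case
    using mult by (simp only:)
qed

section \<open>Gluing the estimates on cubes\<close>

lemma form_cmult: "form w (\<lambda>y. a * f y) (\<lambda>x. b * g x) = a * b * form w f g"
proof -
  have "form w (\<lambda>y. a * f y) (\<lambda>x. b * g x)
    = (\<integral>z. (a * b) * (K (fst z) (snd z) * f (snd z) * g (fst z) * w z) \<partial>(\<nu> \<Otimes>\<^sub>M \<mu>))"
    unfolding form_def by (rule Bochner_Integration.integral_cong) (auto simp: ac_simps)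
  then show ?thesis
    by (simp add: form_def)
qed

text \<open>Averaging over the position \<open>t\<close> of the cube is a continuous version of summing over a grid: the
  local pieces of \<open>f\<close> and \<open>g\<close> have bounded overlap, and Young's inequality plus homogeneity does the
  work of Hoelder's inequality.\<close>

lemma multiplier_of_local:
  fixes w :: "'a \<times> 'a \<Rightarrow> real"
  assumes L: "0 < L" and R: "0 \<le> R"
    and w[measurable]: "w \<in> borel_measurable (\<nu> \<Otimes>\<^sub>M \<mu>)" and M: "\<And>z. \<bar>w z\<bar> \<le> M"
    and supp: "\<And>x y. R < norm (x - y) \<Longrightarrow> w (x, y) = 0"
    and local: "\<And>t. multiplier (\<lambda>z. w z * indicator (cbox t (t + L *\<^sub>R One)) (fst z)) D"
  shows "multiplier w (((L + 2 * R) / L) ^ DIM('a) * D)"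
proof -
  let ?Q = "\<lambda>t::'a. cbox t (t + L *\<^sub>R One)"
  let ?Q' = "\<lambda>t::'a. cbox (t - R *\<^sub>R One) (t + (L + R) *\<^sub>R One)"
  let ?\<kappa> = "((L + 2 * R) / L) ^ DIM('a)"
  have D: "0 \<le> D"
    using multiplierD(3)[OF local] .
  have M0: "0 \<le> M"
    using M[of undefined] by linarith
  \<comment> \<open>If \<open>x\<close> is in the cube at \<open>t\<close>, then every
    \<open>y\<close> that interacts with it lies in the cube enlarged by \<open>R\<close>.\<close>
  have Q'_mem: "y \<in> ?Q' t" if "x \<in> ?Q t" "norm (x - y) \<le> R" for x y t
  proof -
    have "\<bar>x \<bullet> b - y \<bullet> b\<bar> \<le> R" if "b \<in> Basis" for b
      using Basis_le_norm[OF that, of "x - y"] \<open>norm (x - y) \<le> R\<close> by (simp add: inner_diff_left)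
    then show ?thesis
      using that(1) by (fastforce simp: mem_box inner_diff_left inner_add_left)
  qed
  \<comment> \<open>The bound is a sum of powers because powers of the local norms, unlike products
    of norms, are integrals and can be averaged over \<open>t\<close>.\<close>
  have main: "L ^ DIM('a) * \<bar>form w f g\<bar> \<le> (L + 2 * R) ^ DIM('a) * D * (lpn \<mu> p f powr p / p + lpn \<nu> q g powr q / q)"
    if AB: "compact A" "compact B" "A \<inter> B = {}" and f: "bsupp A f" and g: "bsupp B g" for A B f g
  proof -
    obtain a b where ab: "B \<subseteq> cbox a b"
      using bounded_subset_cbox_symmetric[OF compact_imp_bounded[OF AB(2)]] by blast
    \<comment> \<open>This box contains every \<open>t\<close> whose cube meets \<open>B\<close>,
      and it has finite measure.\<close>
    let ?T = "cbox (a - L *\<^sub>R One) b"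
    let ?W = "\<lambda>z. K (fst z) (snd z) * f (snd z) * g (fst z)"
    let ?w = "\<lambda>t z. w z * indicator (?Q t) (fst z)"
    define G where "G t z = indicator ?T t * ?w t z" for t z
    have W: "integrable (\<nu> \<Otimes>\<^sub>M \<mu>) ?W"
      using separated_form_integrable[OF AB f g, of "\<lambda>_. 1" 1] by simp
    have H: "integrable lborel (\<lambda>t. M * indicator ?T t :: real)"
      by (intro integrable_mult_right integrable_real_indicator) (auto simp: emeasure_lborel_cbox_eq)
    have "(\<lambda>(t, z). indicator (cbox (t - 0 *\<^sub>R One) (t + L *\<^sub>R One)) (fst z) :: real)
        \<in> borel_measurable (lborel \<Otimes>\<^sub>M (\<nu> \<Otimes>\<^sub>M \<mu>))"
      by measurable
    then have [measurable]: "(\<lambda>(t, z). indicator (?Q t) (fst z) :: real) \<in> borel_measurable (lborel \<Otimes>\<^sub>M (\<nu> \<Otimes>\<^sub>M \<mu>))"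
      by simp
    have G: "(\<lambda>(t, z). G t z) \<in> borel_measurable (lborel \<Otimes>\<^sub>M (\<nu> \<Otimes>\<^sub>M \<mu>))"
      unfolding G_def by measurable
    have GH: "\<bar>G t z\<bar> \<le> M * indicator ?T t" for t z
      using M[of z] M0 by (auto simp: G_def indicator_def)
    note fub = fubini_parameter[OF sigma_finite_lborel sigma_finite_measure_axioms H W G GH]
    \<comment> \<open>The positions \<open>t\<close> whose cube contains \<open>fst z\<close> have
      total volume \<open>L ^ DIM('a)\<close>, so averaging over \<open>t\<close> reproduces
      \<open>w\<close> up to this factor.\<close>
    have Weq: "?W z * (\<integral>t. G t z \<partial>lborel) = L ^ DIM('a) * (?W z * w z)" for z
    proof (cases "fst z \<in> B")
      case True
      have "G t z = w z * indicator (cbox (fst z - L *\<^sub>R One) (fst z + 0 *\<^sub>R One)) t" for t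
      proof -
        have "t \<in> ?T" if "fst z \<in> ?Q t"
          unfolding mem_box
        proof
          fix i :: 'a
          assume i: "i \<in> Basis"
          have "a \<bullet> i \<le> fst z \<bullet> i" "fst z \<bullet> i \<le> b \<bullet> i"
            using subsetD[OF ab True] i by (auto simp: mem_box)
          moreover have "t \<bullet> i \<le> fst z \<bullet> i" "fst z \<bullet> i \<le> t \<bullet> i + L"
            using that i by (auto simp: mem_box inner_add_left)
          ultimately show "(a - L *\<^sub>R One) \<bullet> i \<le> t \<bullet> i \<and> t \<bullet> i \<le> b \<bullet> i"
            using i by (simp add: inner_diff_left)
        qed
        then show ?thesis
          using cube_mem_swap[of "fst z" t 0 L] by (auto simp: G_def indicator_def)
      qed
      then have "(\<integral>t. G t z \<partial>lborel) = w z * L ^ DIM('a)"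
        using measure_cube[of 0 L "fst z"] L by simp
      then show ?thesis
        by simp
    next
      case False
      then have "?W z = 0"
        using g by (auto simp: bsupp_def)
      then show ?thesis
        by (simp only: mult_zero_left mult_zero_right)
    qed
    have "L ^ DIM('a) * form w f g = (\<integral>z. ?W z * (\<integral>t. G t z \<partial>lborel) \<partial>(\<nu> \<Otimes>\<^sub>M \<mu>))"
      by (simp only: form_def Weq integral_mult_right_zero)
    also have "\<dots> = (\<integral>t. (\<integral>z. ?W z * G t z \<partial>(\<nu> \<Otimes>\<^sub>M \<mu>)) \<partial>lborel)"
      by (rule fub(1))
    finally have eq: "L ^ DIM('a) * form w f g = (\<integral>t. (\<integral>z. ?W z * G t z \<partial>(\<nu> \<Otimes>\<^sub>M \<mu>)) \<partial>lborel)" .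
    let ?F = "\<lambda>t. \<integral>y. \<bar>f y\<bar> powr p * indicator (?Q' t) y \<partial>\<mu>"
    let ?F' = "\<lambda>t. \<integral>x. \<bar>g x\<bar> powr q * indicator (?Q t) x \<partial>\<nu>"
    have bound: "\<bar>form (?w t) f g\<bar> \<le> D * (?F t / p + ?F' t / q)" for t
    proof -
      let ?f = "\<lambda>y. indicator (?Q' t) y * f y" and ?g = "\<lambda>x. indicator (?Q t) x * g x"
      have fg: "bsupp A ?f" "bsupp B ?g"
        using f g by (auto intro!: bsupp_times[where M = 1])
      \<comment> \<open>Cutting \<open>f\<close> and \<open>g\<close> down to the two cubes does not
        change the localised form, because \<open>w\<close> vanishes at distances above
        \<open>R\<close>.\<close>
      have "?W z * ?w t z = K (fst z) (snd z) * ?f (snd z) * ?g (fst z) * ?w t z" for z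
      proof (cases "fst z \<in> ?Q t \<and> norm (fst z - snd z) \<le> R")
        case True
        then have "snd z \<in> ?Q' t"
          using Q'_mem by blast
        with True show ?thesis
          by (simp only: indicator_simps mult_1)
      next
        case False
        then have "?w t z = 0"
          using supp[of "fst z" "snd z"] by (cases "fst z \<in> ?Q t") (simp_all add: not_le)
        then show ?thesis
          by (simp only: mult_zero_right)
      qed
      then have "form (?w t) f g = form (?w t) ?f ?g"
        by (simp only: form_def)
      then have "\<bar>form (?w t) f g\<bar> \<le> D * (lpn \<mu> p ?f * lpn \<nu> q ?g)"
        using multiplierD(4)[OF local AB fg] by (simp only: mult.assoc)
      also have "\<dots> \<le> D * (lpn \<mu> p ?f powr p / p + lpn \<nu> q ?g powr q / q)"
        by (intro mult_left_mono Youngs_inequality p_gt_1 p_q(2,4) lpn_nonneg D)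
      finally have le: "\<bar>form (?w t) f g\<bar> \<le> D * (lpn \<mu> p ?f powr p / p + lpn \<nu> q ?g powr q / q)" .
      have F: "lpn \<mu> p ?f powr p = ?F t"
        unfolding lpn_powr[OF p_q(1)] by (rule Bochner_Integration.integral_cong) (auto simp: indicator_def)
      have F': "lpn \<nu> q ?g powr q = ?F' t"
        unfolding lpn_powr[OF p_q(3)] by (rule Bochner_Integration.integral_cong) (auto simp: indicator_def)
      show ?thesis
        using le unfolding F F' .
    qed
    let ?J = "\<lambda>t. indicator ?T t * ?F t" and ?J' = "\<lambda>t. indicator ?T t * ?F' t"
    have fp: "integrable \<mu> (\<lambda>y. \<bar>f y\<bar> powr p)" and gq: "integrable \<nu> (\<lambda>x. \<bar>g x\<bar> powr q)"
      using p_q(1,3) by (auto intro!: radon_integrable_bsupp[OF radon_\<mu> AB(1)] radon_integrable_bsupp[OF radon_\<nu> AB(2)] bsupp_powr f g)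
    \<comment> \<open>The enlarged cube has side \<open>R + (L + R)\<close>; the overlap of these
      cubes is the source of the factor \<open>L + 2 * R\<close>.\<close>
    have J: "integrable lborel ?J" "(\<integral>t. ?J t \<partial>lborel) \<le> (L + 2 * R) ^ DIM('a) * lpn \<mu> p f powr p"
      using cube_average[OF radon_\<mu> fp, of R "L + R" "a - L *\<^sub>R One" b] L R
      by (simp_all add: lpn_powr p_q(1) algebra_simps)
    have J': "integrable lborel ?J'" "(\<integral>t. ?J' t \<partial>lborel) \<le> L ^ DIM('a) * lpn \<nu> q g powr q"
      using cube_average[OF radon_\<nu> gq, of 0 L "a - L *\<^sub>R One" b] L by (simp_all add: lpn_powr p_q(3))
    have "L ^ DIM('a) * \<bar>form w f g\<bar> = \<bar>\<integral>t. (\<integral>z. ?W z * G t z \<partial>(\<nu> \<Otimes>\<^sub>M \<mu>)) \<partial>lborel\<bar>"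
      unfolding eq[symmetric] using L by (simp add: abs_mult)
    also have "\<dots> \<le> (\<integral>t. \<bar>\<integral>z. ?W z * G t z \<partial>(\<nu> \<Otimes>\<^sub>M \<mu>)\<bar> \<partial>lborel)"
      by (rule integral_abs_bound)
    also have "\<dots> \<le> (\<integral>t. D * (?J t / p + ?J' t / q) \<partial>lborel)"
    proof (rule integral_mono)
      show "integrable lborel (\<lambda>t. \<bar>\<integral>z. ?W z * G t z \<partial>(\<nu> \<Otimes>\<^sub>M \<mu>)\<bar>)"
        by (rule integrable_abs[OF fub(2)])
      show "integrable lborel (\<lambda>t. D * (?J t / p + ?J' t / q))"
        using J(1) J'(1) by auto
      fix t
      have "(\<integral>z. ?W z * G t z \<partial>(\<nu> \<Otimes>\<^sub>M \<mu>)) = (\<integral>z. indicator ?T t * (?W z * ?w t z) \<partial>(\<nu> \<Otimes>\<^sub>M \<mu>))"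
        unfolding G_def by (simp only: mult.left_commute)
      also have "\<dots> = indicator ?T t * form (?w t) f g"
        by (simp only: form_def integral_mult_right_zero)
      finally have eq: "(\<integral>z. ?W z * G t z \<partial>(\<nu> \<Otimes>\<^sub>M \<mu>)) = indicator ?T t * form (?w t) f g" .
      show "\<bar>\<integral>z. ?W z * G t z \<partial>(\<nu> \<Otimes>\<^sub>M \<mu>)\<bar> \<le> D * (?J t / p + ?J' t / q)"
      proof (cases "t \<in> ?T")
        case True
        then have "indicator ?T t = (1 :: real)"
          by simp
        then show ?thesis
          unfolding eq by (simp only: mult_1 bound)
      next
        case False
        then have "indicator ?T t = (0 :: real)"
          by simp
        then show ?thesis
          unfolding eq by (simp only: mult_zero_left abs_zero div_0 add_0_left mult_zero_right order_refl)
      qed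
    qed
    also have "\<dots> = D * ((\<integral>t. ?J t \<partial>lborel) / p + (\<integral>t. ?J' t \<partial>lborel) / q)"
      using J(1) J'(1) by simp
    also have "\<dots> \<le> D * ((L + 2 * R) ^ DIM('a) * lpn \<mu> p f powr p / p + (L + 2 * R) ^ DIM('a) * lpn \<nu> q g powr q / q)"
    proof (intro mult_left_mono add_mono divide_right_mono J(2))
      have "L ^ DIM('a) \<le> (L + 2 * R) ^ DIM('a)"
        using L R by (intro power_mono) auto
      then show "(\<integral>t. ?J' t \<partial>lborel) \<le> (L + 2 * R) ^ DIM('a) * lpn \<nu> q g powr q"
        using J'(2) by (meson order_trans mult_right_mono powr_ge_zero)
    qed (use p_q(1,3) D in auto)
    finally show ?thesis
      by (simp add: algebra_simps)
  qed
  have "\<bar>form w f g\<bar> \<le> (?\<kappa> * D) * lpn \<mu> p f * lpn \<nu> q g"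
    if AB: "compact A" "compact B" "A \<inter> B = {}" and f: "bsupp A f" and g: "bsupp B g" for A B f g
  proof (rule le_product_of_scaled_Young[OF p_gt_1 q_eq])
    show "0 \<le> ?\<kappa> * D"
      using D L R by simp
    show "0 \<le> lpn \<mu> p f" "0 \<le> lpn \<nu> q g"
      by (rule lpn_nonneg)+
    fix a b :: real
    assume ab: "0 < a" "0 < b"
    \<comment> \<open>\<open>main\<close> applied to the multiples of \<open>f\<close> by
      \<open>a\<close> and of \<open>g\<close> by \<open>b\<close>.\<close>
    have "L ^ DIM('a) * \<bar>a * b * form w f g\<bar> \<le> (L + 2 * R) ^ DIM('a) * D
        * ((a * lpn \<mu> p f) powr p / p + (b * lpn \<nu> q g) powr q / q)"
      using main[OF AB bsupp_cmult[OF f, of a] bsupp_cmult[OF g, of b]] ab p_q(1,3)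
      by (simp add: form_cmult lpn_cmult)
    then show "a * b * \<bar>form w f g\<bar> \<le> ?\<kappa> * D * ((a * lpn \<mu> p f) powr p / p + (b * lpn \<nu> q g) powr q / q)"
      using L ab by (simp add: abs_mult power_divide pos_le_divide_eq mult.commute)
  qed
  moreover have "0 \<le> ?\<kappa> * D"
    using D L R by simp
  ultimately show ?thesis
    by (intro multiplierI[OF w M])
qed

text \<open>The weight \<open>1 - h (x - y)\<close> has range \<open>R\<close>. On each cube it is
  the indicator, which costs \<open>C\<close>, minus the weight of \<open>multiplier_on_cube\<close>
  with all coordinates, which costs \<open>2 ^ DIM('a) * M * C\<close>. Gluing and subtracting from
  1 gives \<open>h\<close>. Only the ratio of \<open>R\<close> to \<open>L\<close> enters the
  constant.\<close>

lemma multiplier_compactly_perturbed: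
  fixes h :: "'a \<Rightarrow> real"
  assumes L: "0 < L" and R: "0 \<le> R" and h: "dbound L M DIM('a) h"
    and h1: "\<And>z. R < norm z \<Longrightarrow> h z = 1"
  shows "multiplier (\<lambda>z. h (fst z - snd z)) (C + ((L + 2 * R) / L) ^ DIM('a) * (C + 2 ^ DIM('a) * M * C))"
proof -
  have [measurable]: "h \<in> borel_measurable borel"
    by (rule borel_measurable_continuous_onI[OF dbound_continuous[OF h]])
  let ?w = "\<lambda>z::'a \<times> 'a. 1 - h (fst z - snd z)"
  have "multiplier ?w (((L + 2 * R) / L) ^ DIM('a) * (C + 2 ^ DIM('a) * M * C))"
  proof (rule multiplier_of_local[OF L R])
    show "?w \<in> borel_measurable (\<nu> \<Otimes>\<^sub>M \<mu>)"
      by measurable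
    show "\<bar>?w z\<bar> \<le> 1 + M" for z
      using dbound_le[OF h, of "fst z - snd z"] by linarith
    show "?w (x, y) = 0" if "R < norm (x - y)" for x y
      using h1[OF that] by simp
    fix t :: 'a
    let ?Q = "cbox t (t + L *\<^sub>R One)"
    have "multiplier (\<lambda>z. indicator ?Q (fst z) * 1 * 1) (1 * C)"
      by (rule multiplier_product[OF multiplier_one]) (auto simp: indicator_def)
    from multiplier_add[OF this multiplier_on_cube[OF L finite_Basis order_refl h, of t], of "- 1"]
    show "multiplier (\<lambda>z. ?w z * indicator ?Q (fst z)) (C + 2 ^ DIM('a) * M * C)"
      by (simp add: coord_proj_Basis left_diff_distrib)
  qed
  from multiplier_add[OF multiplier_one this, of "- 1"] show ?thesis
    by simp
qed

section \<open>Kernels vanishing near the diagonal\<close>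

text \<open>Here \<open>A\<close> and \<open>B\<close> may overlap: the vanishing of
  \<open>w\<close> confines the integrand to pairs at distance at least \<open>d\<close>, a closed
  set off the diagonal.\<close>

lemma multiplier_near_diagonal_integrable:
  assumes w: "multiplier w D" and d: "0 < d" "\<And>x y. norm (x - y) < d \<Longrightarrow> w (x, y) = 0"
    and AB: "compact A" "compact B" and f: "bsupp A f" and g: "bsupp B g"
  shows "integrable (\<nu> \<Otimes>\<^sub>M \<mu>) (\<lambda>z. K (fst z) (snd z) * f (snd z) * g (fst z) * w z)"
proof -
  obtain M where M: "\<And>z. \<bar>w z\<bar> \<le> M"
    using multiplierD(2)[OF w] by (auto simp: bounded_iff)
  show ?thesis
  proof (rule form_integrable[OF AB f g multiplierD(1)[OF w] M])
    show "closed {z :: 'a \<times> 'a. d \<le> norm (fst z - snd z)}"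
      by (intro closed_Collect_le continuous_intros)
    show "w z = 0" if "z \<notin> {z. d \<le> norm (fst z - snd z)}" for z
      using d(2)[of "fst z" "snd z"] that by simp
  qed (use d in auto)
qed

text \<open>Averaging over all \<open>T\<close>: for \<open>x\<close> and \<open>y\<close> in different pieces, one subset \<open>T\<close> out of four contains
  the piece of \<open>y\<close> but not that of \<open>x\<close>; within a single piece \<open>w\<close> vanishes.\<close>

lemma form_on_disjoint_pieces:
  fixes P :: "nat \<Rightarrow> 'a set" and N :: nat
  assumes w: "multiplier w D" and d: "0 < d" "\<And>x y. norm (x - y) < d \<Longrightarrow> w (x, y) = 0"
    and AB: "compact A" "compact B" and f: "bsupp A f" and g: "bsupp B g"
    and P: "\<And>i. compact (P i)" "\<And>i x y. x \<in> P i \<Longrightarrow> y \<in> P i \<Longrightarrow> norm (x - y) < d"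
      "\<And>i j. i \<noteq> j \<Longrightarrow> P i \<inter> P j = {}"
  defines "U \<equiv> \<Union>i<N. P i"
  shows "\<bar>form w (\<lambda>y. indicator U y * f y) (\<lambda>x. indicator U x * g x)\<bar> \<le> 4 * D * lpn \<mu> p f * lpn \<nu> q g"
proof -
  define V where "V T = (\<Union>i\<in>T. P i)" for T
  let ?I = "{..<N}" and ?R = "D * lpn \<mu> p f * lpn \<nu> q g"
  let ?W = "\<lambda>z. K (fst z) (snd z) * f (snd z) * g (fst z) * w z"
  let ?F = "\<lambda>T. form w (\<lambda>y. indicator (V T) y * f y) (\<lambda>x. indicator (V (?I - T)) x * g x)"
  have W: "integrable (\<nu> \<Otimes>\<^sub>M \<mu>) ?W"
    by (rule multiplier_near_diagonal_integrable[OF w d AB f g])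
  have V: "compact (V T)" if "T \<subseteq> ?I" for T
    unfolding V_def using P(1) that finite_subset by (intro compact_UN) auto
  have V_meas: "V T \<in> sets borel" if "T \<subseteq> ?I" for T
    using V[OF that] by (rule borel_compact)
  have bound: "\<bar>?F T\<bar> \<le> ?R" if T: "T \<subseteq> ?I" for T
  proof -
    let ?f = "\<lambda>y. indicator (V T) y * f y" and ?g = "\<lambda>x. indicator (V (?I - T)) x * g x"
    have T': "?I - T \<subseteq> ?I"
      by auto
    have A: "bsupp A ?f" "bsupp B ?g"
      using f g V_meas[OF T] V_meas[OF T'] by (auto intro!: bsupp_times[where M = 1])
    \<comment> \<open>The sets \<open>V T\<close> and \<open>V (?I - T)\<close> now serve as
      supports: they are compact and disjoint even when \<open>A\<close> and \<open>B\<close>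
      meet.\<close>
    then have "bsupp (V T) ?f" "bsupp (V (?I - T)) ?g"
      by (auto simp: bsupp_def)
    moreover have "V T \<inter> V (?I - T) = {}"
    proof (rule equals0I)
      fix x
      assume "x \<in> V T \<inter> V (?I - T)"
      then obtain i j where "i \<in> T" "j \<notin> T" "x \<in> P i" "x \<in> P j"
        by (auto simp: V_def)
      then show False
        using P(3)[of i j] by auto
    qed
    ultimately have "\<bar>?F T\<bar> \<le> D * lpn \<mu> p ?f * lpn \<nu> q ?g"
      by (intro multiplierD(4)[OF w V[OF T] V[OF T']])
    also have "\<dots> \<le> ?R"
    proof (intro mult_mono)
      show "lpn \<mu> p ?f \<le> lpn \<mu> p f"
        by (rule lpn_mono[OF radon_\<mu> AB(1) p_q(1) A(1) f]) (auto simp: indicator_def)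
      show "lpn \<nu> q ?g \<le> lpn \<nu> q g"
        by (rule lpn_mono[OF radon_\<nu> AB(2) p_q(3) A(2) g]) (auto simp: indicator_def)
    qed (auto intro!: mult_nonneg_nonneg lpn_nonneg multiplierD(3)[OF w])
    finally show ?thesis .
  qed
  define c where "c T z = (indicator (V T) (snd z) * indicator (V (?I - T)) (fst z) :: real)" for T z
  have F: "?F T = (\<integral>z. ?W z * c T z \<partial>(\<nu> \<Otimes>\<^sub>M \<mu>))" for T
    unfolding form_def c_def by (rule Bochner_Integration.integral_cong) (auto simp: ac_simps)
  have int: "integrable (\<nu> \<Otimes>\<^sub>M \<mu>) (\<lambda>z. ?W z * c T z)" if "T \<in> Pow ?I" for T
  proof (rule Bochner_Integration.integrable_bound[OF W])
    have [measurable]: "V T \<in> sets borel" "V (?I - T) \<in> sets borel"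
      using that by (auto intro: V_meas)
    have [measurable]: "?W \<in> borel_measurable (\<nu> \<Otimes>\<^sub>M \<mu>)"
      using W by (rule borel_measurable_integrable)
    show "(\<lambda>z. ?W z * c T z) \<in> borel_measurable (\<nu> \<Otimes>\<^sub>M \<mu>)"
      unfolding c_def by (rule borel_measurable_times, fact) measurable
    show "AE z in \<nu> \<Otimes>\<^sub>M \<mu>. norm (?W z * c T z) \<le> norm (?W z)"
      by (intro AE_I2) (simp add: c_def indicator_def)
  qed
  have key: "(\<Sum>T\<in>Pow ?I. ?W z * c T z) * 4 = 2 ^ N * (?W z * (indicator U (snd z) * indicator U (fst z)))" for z
  proof (cases "snd z \<in> U \<and> fst z \<in> U \<and> d \<le> norm (fst z - snd z)")
    case True
    then obtain i j where ij: "i < N" "j < N" "fst z \<in> P i" "snd z \<in> P j"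
      by (auto simp: U_def)
    have "i \<noteq> j"
      using P(2)[of "fst z" i "snd z"] ij True by auto
    have mem: "fst z \<in> P k \<longleftrightarrow> k = i" "snd z \<in> P k \<longleftrightarrow> k = j" for k
      using ij P(3) by blast+
    have "c T z = (if j \<in> T \<and> i \<notin> T then 1 else 0)" for T
      using ij by (auto simp: c_def V_def mem indicator_def)
    then have "(\<Sum>T\<in>Pow ?I. c T z) = real (card {T \<in> Pow ?I. j \<in> T \<and> i \<notin> T})"
      by (simp add: sum.If_cases Int_def)
    also have "\<dots> * 4 = real (card {T \<in> Pow ?I. j \<in> T \<and> i \<notin> T} * 4)"
      by simp
    also have "\<dots> = 2 ^ N"
      using ij \<open>i \<noteq> j\<close> by (subst card_subsets_separating) auto
    finally show ?thesis
      using True by (simp add: sum_distrib_left[symmetric])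
  next
    case False
    have "?W z * c T z = 0 \<and> ?W z * (indicator U (snd z) * indicator U (fst z)) = 0" if "T \<in> Pow ?I" for T
    proof (cases "norm (fst z - snd z) < d")
      case True
      then have "?W z = 0"
        using d(2)[of "fst z" "snd z"] by simp
      then show ?thesis
        by (simp only: mult_zero_left simp_thms)
    next
      case far: False
      then have "c T z = 0" "indicator U (snd z) * indicator U (fst z) = (0 :: real)"
        using False that by (auto simp: c_def V_def U_def indicator_def)
      then show ?thesis
        by (simp only: mult_zero_right simp_thms)
    qed
    moreover have "?I \<in> Pow ?I"
      by simp
    ultimately show ?thesis
      by (simp only: sum.neutral_const mult_zero_left mult_zero_right cong: sum.cong)
  qed
  let ?f = "\<lambda>y. indicator U y * f y" and ?g = "\<lambda>x. indicator U x * g x"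
  have "2 ^ N * form w ?f ?g = (\<integral>z. 2 ^ N * (?W z * (indicator U (snd z) * indicator U (fst z))) \<partial>(\<nu> \<Otimes>\<^sub>M \<mu>))"
    unfolding form_def integral_mult_right_zero[symmetric]
    by (rule Bochner_Integration.integral_cong) (auto simp: ac_simps)
  also have "\<dots> = (\<integral>z. (\<Sum>T\<in>Pow ?I. ?W z * c T z) * 4 \<partial>(\<nu> \<Otimes>\<^sub>M \<mu>))"
    by (simp only: key)
  also have "\<dots> = (\<Sum>T\<in>Pow ?I. ?F T) * 4"
    by (simp only: integral_mult_left_zero F Bochner_Integration.integral_sum[OF int])
  finally have eq: "2 ^ N * form w ?f ?g = (\<Sum>T\<in>Pow ?I. ?F T) * 4" .
  \<comment> \<open>Each of the \<open>2 ^ N\<close> selections contributes at most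
    \<open>?R\<close>; the powers of 2 cancel and the factor 4 remains.\<close>
  have "\<bar>\<Sum>T\<in>Pow ?I. ?F T\<bar> \<le> (\<Sum>T\<in>Pow ?I. ?R)"
    by (rule order_trans[OF sum_abs sum_mono]) (rule bound, simp)
  also have "\<dots> = 2 ^ N * ?R"
    by (simp add: card_Pow)
  finally have "\<bar>2 ^ N * form w ?f ?g\<bar> \<le> 2 ^ N * ?R * 4"
    unfolding eq abs_mult by simp
  then have "2 ^ N * \<bar>form w ?f ?g\<bar> \<le> 2 ^ N * (4 * ?R)"
    by (simp add: abs_mult)
  then have "\<bar>form w ?f ?g\<bar> \<le> 4 * ?R"
    by (rule mult_left_le_imp_le) simp
  then show ?thesis
    by (simp only: mult.assoc)
qed

text \<open>The bound on disjoint pieces does not depend on how much of \<open>A \<union> B\<close>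
  they cover. Their unions \<open>U n\<close> eventually contain each of its points, and the full
  integrand is an integrable majorant, so dominated convergence removes the cutoffs.\<close>

lemma multiplier_near_diagonal_bounded:
  assumes w: "multiplier w D" and d: "0 < d" "\<And>x y. norm (x - y) < d \<Longrightarrow> w (x, y) = 0"
    and AB: "compact A" "compact B" and f: "bsupp A f" and g: "bsupp B g"
  shows "\<bar>form w f g\<bar> \<le> 4 * D * lpn \<mu> p f * lpn \<nu> q g"
proof -
  have "compact (A \<union> B)"
    using AB by (rule compact_Un)
  then obtain N and P :: "nat \<Rightarrow> nat \<Rightarrow> 'a set"
    where P: "\<And>n i. compact (P n i)" "\<And>n i x y. x \<in> P n i \<Longrightarrow> y \<in> P n i \<Longrightarrow> norm (x - y) < d"
    "\<And>n i j. i \<noteq> j \<Longrightarrow> P n i \<inter> P n j = {}"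
    "\<And>x. x \<in> A \<union> B \<Longrightarrow> eventually (\<lambda>n. \<exists>i<N. x \<in> P n i) sequentially"
    by (rule compact_approximate_partition[OF _ d(1)]) (use that in blast)
  define U where "U n = (\<Union>i<N. P n i)" for n
  let ?W = "\<lambda>z. K (fst z) (snd z) * f (snd z) * g (fst z) * w z"
  have W: "integrable (\<nu> \<Otimes>\<^sub>M \<mu>) ?W"
    by (rule multiplier_near_diagonal_integrable[OF w d AB f g])
  have [measurable]: "?W \<in> borel_measurable (\<nu> \<Otimes>\<^sub>M \<mu>)"
    using W by (rule borel_measurable_integrable)
  have [measurable]: "U n \<in> sets borel" for n
    unfolding U_def using P(1) by (intro borel_compact compact_UN) auto
  have "(\<lambda>n. \<integral>z. ?W z * (indicator (U n) (snd z) * indicator (U n) (fst z)) \<partial>(\<nu> \<Otimes>\<^sub>M \<mu>)) \<longlonglongrightarrow> (\<integral>z. ?W z \<partial>(\<nu> \<Otimes>\<^sub>M \<mu>))"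
  proof (rule integral_dominated_convergence)
    show "integrable (\<nu> \<Otimes>\<^sub>M \<mu>) (\<lambda>z. norm (?W z))"
      using W by (rule integrable_norm)
    show "(\<lambda>z. ?W z * (indicator (U n) (snd z) * indicator (U n) (fst z))) \<in> borel_measurable (\<nu> \<Otimes>\<^sub>M \<mu>)" for n
      by (rule borel_measurable_times) measurable
    show "AE z in \<nu> \<Otimes>\<^sub>M \<mu>. norm (?W z * (indicator (U n) (snd z) * indicator (U n) (fst z))) \<le> norm (?W z)" for n
      by (intro AE_I2) (simp add: indicator_def)
    show "AE z in \<nu> \<Otimes>\<^sub>M \<mu>. (\<lambda>n. ?W z * (indicator (U n) (snd z) * indicator (U n) (fst z))) \<longlonglongrightarrow> ?W z"
    proof (intro AE_I2)
      fix z
      show "(\<lambda>n. ?W z * (indicator (U n) (snd z) * indicator (U n) (fst z))) \<longlonglongrightarrow> ?W z"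
      proof (cases "fst z \<in> B \<and> snd z \<in> A")
        case True
        then have "eventually (\<lambda>n. snd z \<in> U n) sequentially" "eventually (\<lambda>n. fst z \<in> U n) sequentially"
          using P(4)[of "snd z"] P(4)[of "fst z"] by (simp_all add: U_def Bex_def)
        then have "eventually (\<lambda>n. ?W z * (indicator (U n) (snd z) * indicator (U n) (fst z)) = ?W z) sequentially"
          by eventually_elim simp
        then show ?thesis
          by (rule tendsto_eventually)
      next
        case False
        then have "?W z = 0"
          using f g by (auto simp: bsupp_def)
        then show ?thesis
          by (simp only: mult_zero_left tendsto_const)
      qed
    qed
  qed simp
  moreover have "(\<integral>z. ?W z * (indicator (U n) (snd z) * indicator (U n) (fst z)) \<partial>(\<nu> \<Otimes>\<^sub>M \<mu>))
      = form w (\<lambda>y. indicator (U n) y * f y) (\<lambda>x. indicator (U n) x * g x)" for n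
    unfolding form_def by (rule Bochner_Integration.integral_cong) (auto simp: ac_simps)
  ultimately have "(\<lambda>n. \<bar>form w (\<lambda>y. indicator (U n) y * f y) (\<lambda>x. indicator (U n) x * g x)\<bar>) \<longlonglongrightarrow> \<bar>form w f g\<bar>"
    unfolding form_def[of w f g] by (intro tendsto_rabs) simp
  then show ?thesis
    by (rule LIMSEQ_le_const2)
      (use form_on_disjoint_pieces[OF w d AB f g P(1-3), where N = N] in \<open>auto simp: U_def\<close>)
qed

text \<open>Duality with an explicit extremal test function. The truncation to \<open>E n\<close>
  makes it bounded with compact support, and monotone convergence removes the truncation.\<close>

lemma near_diagonal_operator_bound:
  assumes w: "multiplier w D" and d: "0 < d" "\<And>x y. norm (x - y) < d \<Longrightarrow> w (x, y) = 0"
    and A: "compact A" and f: "bsupp A f"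
  shows "Lp_norm \<nu> p (\<lambda>x. \<integral>y. K x y * w (x, y) * f y \<partial>\<mu>) \<le> ennreal (4 * D) * Lp_norm \<mu> p f"
proof -
  define T where "T x = (\<integral>y. K x y * w (x, y) * f y \<partial>\<mu>)" for x
  have [measurable]: "f \<in> borel_measurable borel"
    using f by (simp add: bsupp_def)
  have [measurable]: "w \<in> borel_measurable (\<nu> \<Otimes>\<^sub>M \<mu>)"
    by (rule multiplierD[OF w])
  have "(\<lambda>z. K (fst z) (snd z) * w z * f (snd z)) \<in> borel_measurable (\<nu> \<Otimes>\<^sub>M \<mu>)"
    by measurable
  then have "(\<lambda>(x, y). K x y * w (x, y) * f y) \<in> borel_measurable (\<nu> \<Otimes>\<^sub>M \<mu>)"
    by (simp add: case_prod_beta')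
  then have "T \<in> borel_measurable \<nu>"
    unfolding T_def by (rule M2.borel_measurable_lebesgue_integral)
  then have T[measurable]: "T \<in> borel_measurable borel"
    by (simp add: measurable_cong_sets[OF sets_borel(2) refl])
  define c where "c = 4 * D * lpn \<mu> p f"
  have c: "0 \<le> c"
    using multiplierD(3)[OF w] by (simp add: c_def lpn_nonneg)
  define E where "E n = {x. \<bar>T x\<bar> \<le> real n} \<inter> cball 0 (real n)" for n
  have [measurable]: "E n \<in> sets borel" for n
    unfolding E_def by measurable
  define F where "F n x = indicator (E n) x * \<bar>T x\<bar> powr p" for n x
  \<comment> \<open>Since \<open>(p - 1) * q = p\<close>, both \<open>T x * g n x\<close> and
    \<open>\<bar>g n x\<bar> powr q\<close> equal \<open>F n x\<close>.\<close>
  define g where "g n x = indicator (E n) x * (sgn (T x) * \<bar>T x\<bar> powr (p - 1))" for n x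
  have bsupp_g: "bsupp (cball 0 (real n)) (g n)" for n
  proof -
    have "\<bar>g n x\<bar> \<le> real n powr (p - 1)" for x
      using p_gt_1 by (auto simp: g_def E_def indicator_def abs_mult sgn_if intro!: powr_mono2)
    then have "bounded (range (g n))"
      by (rule bounded_range_abs)
    moreover have "g n \<in> borel_measurable borel"
      unfolding g_def by measurable
    ultimately show ?thesis
      by (auto simp: bsupp_def g_def E_def)
  qed
  have g_F: "\<bar>g n x\<bar> powr q = F n x" for n x
    using p_q(3) by (auto simp: g_def F_def indicator_def abs_mult sgn_if powr_powr p_q(5))
  have T_F: "T x * g n x = F n x" for n x
  proof -
    have "T x * sgn (T x) * \<bar>T x\<bar> powr (p - 1) = \<bar>T x\<bar> powr p"
      using p_gt_1 by (cases "T x = 0") (auto simp: mult_sgn_abs abs_sgn[symmetric] powr_mult_base)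
    then show ?thesis
      by (simp add: g_def F_def indicator_def)
  qed
  have int_F: "integrable \<nu> (F n)" for n
    using radon_integrable_bsupp[OF radon_\<nu> compact_cball bsupp_powr[OF bsupp_g p_q(3)]] unfolding g_F .
  have F_nonneg: "0 \<le> F n x" for n x
    by (simp add: F_def)
  have I_le: "(\<integral>x. F n x \<partial>\<nu>) \<le> c powr p" for n
  proof -
    let ?I = "\<integral>x. F n x \<partial>\<nu>"
    have I0: "0 \<le> ?I"
      using F_nonneg by (rule Bochner_Integration.integral_nonneg)
    have "form w f (g n) = (\<integral>x. (\<integral>y. K x y * f y * g n x * w (x, y) \<partial>\<mu>) \<partial>\<nu>)"
      using integral_fst'[OF multiplier_near_diagonal_integrable[OF w d A compact_cball f bsupp_g]]
      by (simp add: form_def)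
    also have "(\<lambda>x. \<integral>y. K x y * f y * g n x * w (x, y) \<partial>\<mu>) = (\<lambda>x. T x * g n x)"
      unfolding T_def integral_mult_left_zero[symmetric]
      by (intro ext Bochner_Integration.integral_cong) (auto simp: ac_simps)
    finally have "?I = form w f (g n)"
      by (simp only: T_F)
    also have "\<dots> \<le> c * lpn \<nu> q (g n)"
      using multiplier_near_diagonal_bounded[OF w d A compact_cball f bsupp_g, of n] by (simp add: c_def)
    also have "lpn \<nu> q (g n) = ?I powr (1 / q)"
      by (simp only: lpn_def g_F)
    finally have le: "?I \<le> c * ?I powr (1 / q)" .
    show ?thesis
    proof (cases "?I = 0")
      case False
      then have pos: "0 < ?I"
        using I0 by simp
      \<comment> \<open>Because \<open>1 / p + 1 / q = 1\<close>, dividing by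
        \<open>?I powr (1 / q)\<close> leaves \<open>?I powr (1 / p) \<le> c\<close>; the integral
        is positive here, and it is a genuine one by \<open>int_F\<close>.\<close>
      have "?I powr (1 / p) * ?I powr (1 / q) = ?I"
        using pos p_q(4) by (simp add: powr_add[symmetric])
      then have "?I powr (1 / p) * ?I powr (1 / q) \<le> c * ?I powr (1 / q)"
        using le by (simp only:)
      then have "?I powr (1 / p) \<le> c"
        using pos by simp
      then have "(?I powr (1 / p)) powr p \<le> c powr p"
        using p_q(1) by (intro powr_mono2) auto
      then show ?thesis
        using pos p_q(1) by (simp add: powr_powr)
    qed simp
  qed
  have "(\<integral>\<^sup>+x. ennreal (\<bar>T x\<bar> powr p) \<partial>\<nu>) \<le> (\<integral>\<^sup>+x. (SUP n. ennreal (F n x)) \<partial>\<nu>)"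
  proof (rule nn_integral_mono)
    fix x
    obtain n where n: "max \<bar>T x\<bar> (norm x) \<le> real n"
      using real_arch_simple by blast
    then have "\<bar>T x\<bar> powr p = F n x"
      by (simp add: F_def E_def)
    then show "ennreal (\<bar>T x\<bar> powr p) \<le> (SUP n. ennreal (F n x))"
      using SUP_upper[of n UNIV "\<lambda>n. ennreal (F n x)"] by (simp only: UNIV_I)
  qed
  also have "\<dots> = (SUP n. \<integral>\<^sup>+x. ennreal (F n x) \<partial>\<nu>)"
  proof (rule nn_integral_monotone_convergence_SUP)
    show "incseq (\<lambda>n x. ennreal (F n x))"
      by (intro incseq_SucI le_funI ennreal_leI) (auto simp: F_def E_def indicator_def)
    show "(\<lambda>x. ennreal (F n x)) \<in> borel_measurable \<nu>" for n
      using int_F[of n] by (intro measurable_compose[OF borel_measurable_integrable measurable_ennreal])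
  qed
  also have "\<dots> \<le> ennreal (c powr p)"
  proof (rule SUP_least)
    show "(\<integral>\<^sup>+x. ennreal (F n x) \<partial>\<nu>) \<le> ennreal (c powr p)" for n
      using nn_integral_eq_integral[OF int_F[of n]] F_nonneg I_le[of n] by (simp add: ennreal_leI)
  qed
  finally have le: "(\<integral>\<^sup>+x. ennreal (\<bar>T x\<bar> powr p) \<partial>\<nu>) \<le> ennreal (c powr p)" .
  \<comment> \<open>Finiteness excludes the infinite branch in the definition of
    \<open>Lp_norm\<close>.\<close>
  then have fin: "(\<integral>\<^sup>+x. ennreal (\<bar>T x\<bar> powr p) \<partial>\<nu>) \<noteq> \<infinity>"
    by (rule neq_top_trans[OF ennreal_neq_top, folded infinity_ennreal_def])
  have "enn2real (\<integral>\<^sup>+x. ennreal (\<bar>T x\<bar> powr p) \<partial>\<nu>) \<le> c powr p"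
    using le by (rule enn2real_leI[rotated]) simp
  then have "enn2real (\<integral>\<^sup>+x. ennreal (\<bar>T x\<bar> powr p) \<partial>\<nu>) powr (1 / p) \<le> (c powr p) powr (1 / p)"
    using p_q(1) by (intro powr_mono2) auto
  also have "\<dots> = c"
    using c p_q(1) by (simp add: powr_powr)
  finally have "Lp_norm \<nu> p T \<le> ennreal c"
    using fin by (simp add: Lp_norm_def ennreal_leI)
  also have "ennreal c = ennreal (4 * D) * Lp_norm \<mu> p f"
    unfolding Lp_norm_eq_lpn[OF radon_\<mu> A p_q(1) f] c_def
    using multiplierD(3)[OF w] by (simp add: ennreal_mult lpn_nonneg)
  finally show ?thesis
    unfolding T_def .
qed

end

section \<open>Uniformity over the scale\<close>

theorem theorem3p1:
  fixes \<mu> \<nu> :: "'a::euclidean_space measure"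
    and p :: real
    and K :: "'a \<Rightarrow> 'a \<Rightarrow> real"
    and m :: "'a \<Rightarrow> real"
  assumes "radon \<mu>" and "radon \<nu>"
    and "\<forall>x. emeasure \<mu> {x} = 0 \<or> emeasure \<nu> {x} = 0"
    and "1 < p"
    and "(\<lambda>(x, y). K x y) \<in> borel_measurable (\<nu> \<Otimes>\<^sub>M \<mu>)"
    and "L2loc_offdiag \<mu> \<nu> K"
    and "restr_bounded \<mu> \<nu> p K"
    and "smooth m" and "bounded (range m)"
    and "\<exists>r>0. \<forall>z. norm z < r \<longrightarrow> m z = 0"
    and "\<exists>R. \<forall>z. R < norm z \<longrightarrow> m z = 1"
  shows "\<exists>C::real. \<forall>\<epsilon>>0. \<forall>f. bcs \<mu> f \<longrightarrow>
           Lp_norm \<nu> p (\<lambda>x. \<integral>y. K x y * m ((x - y) /\<^sub>R \<epsilon>) * f y \<partial>\<mu>)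
             \<le> ennreal C * Lp_norm \<mu> p f"
proof -
  obtain C0 where C0: "\<forall>f g A B. f \<in> borel_measurable \<mu> \<longrightarrow> bounded (range f) \<longrightarrow>
        g \<in> borel_measurable \<nu> \<longrightarrow> bounded (range g) \<longrightarrow>
        compact A \<longrightarrow> compact B \<longrightarrow> A \<inter> B = {} \<longrightarrow>
        (\<forall>y. y \<notin> A \<longrightarrow> f y = 0) \<longrightarrow> (\<forall>x. x \<notin> B \<longrightarrow> g x = 0) \<longrightarrow>
        ennreal \<bar>\<integral>x. (\<integral>y. K x y * f y \<partial>\<mu>) * g x \<partial>\<nu>\<bar>
          \<le> ennreal C0 * Lp_norm \<mu> p f * Lp_norm \<nu> (p / (p - 1)) g"
    using \<open>restr_bounded \<mu> \<nu> p K\<close> unfolding restr_bounded_def by blast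
  \<comment> \<open>\<open>ennreal\<close> sends negative reals to 0, so passing to the nonnegative
    part leaves the bound unchanged.\<close>
  define C where "C = max 0 C0"
  let ?q = "p / (p - 1)"
  have meas: "f \<in> borel_measurable \<mu> \<longleftrightarrow> f \<in> borel_measurable borel"
    "f \<in> borel_measurable \<nu> \<longleftrightarrow> f \<in> borel_measurable borel" for f :: "'a \<Rightarrow> real"
    using measurable_cong_sets[OF radon_sets[OF \<open>radon \<mu>\<close>] refl]
      measurable_cong_sets[OF radon_sets[OF \<open>radon \<nu>\<close>] refl] by blast+
  interpret restricted_kernel \<mu> \<nu> p ?q C K
  proof
    fix A B :: "'a set" and f g :: "'a \<Rightarrow> real"
    assume AB: "compact A" "compact B" "A \<inter> B = {}" and f: "bsupp A f" and g: "bsupp B g"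
    have "0 < p" "0 < ?q"
      using \<open>1 < p\<close> by auto
    have "ennreal \<bar>\<integral>x. (\<integral>y. K x y * f y \<partial>\<mu>) * g x \<partial>\<nu>\<bar>
        \<le> ennreal C0 * Lp_norm \<mu> p f * Lp_norm \<nu> ?q g"
      by (rule C0[rule_format, of f g A B]) (use AB f g in \<open>auto simp: bsupp_def meas\<close>)
    also have "\<dots> = ennreal C * ennreal (lpn \<mu> p f) * ennreal (lpn \<nu> ?q g)"
      unfolding Lp_norm_eq_lpn[OF \<open>radon \<mu>\<close> AB(1) \<open>0 < p\<close> f] Lp_norm_eq_lpn[OF \<open>radon \<nu>\<close> AB(2) \<open>0 < ?q\<close> g]
      by (cases "0 \<le> C0") (auto simp: C_def ennreal_neg)
    also have "\<dots> = ennreal (C * lpn \<mu> p f * lpn \<nu> ?q g)"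
      by (simp add: ennreal_mult lpn_nonneg C_def)
    finally show "\<bar>\<integral>x. (\<integral>y. K x y * f y \<partial>\<mu>) * g x \<partial>\<nu>\<bar> \<le> C * lpn \<mu> p f * lpn \<nu> ?q g"
      by (subst (asm) ennreal_le_iff) (auto simp: C_def lpn_nonneg)
  qed (use assms in \<open>auto simp: C_def\<close>)
  let ?d = "DIM('a)"
  obtain r where r: "0 < r" "\<And>z. norm z < r \<Longrightarrow> m z = 0"
    using assms(10) by blast
  obtain R0 where R0: "\<And>z. R0 < norm z \<Longrightarrow> m z = 1"
    using assms(11) by blast
  define R where "R = max 0 R0"
  have R: "0 \<le> R" "\<And>z. R < norm z \<Longrightarrow> m z = 1"
    using R0 by (auto simp: R_def)
  obtain M where M: "dbound 1 M ?d m"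
    using Ck_imp_dbound[of ?d m R 1] R(2) \<open>smooth m\<close> by (auto simp: smooth_def)
  \<comment> \<open>The constant of \<open>multiplier_compactly_perturbed\<close> for
    \<open>L = 1\<close>; at scale \<epsilon> both \<open>L\<close> and \<open>R\<close> are
    multiplied by \<epsilon>, which leaves it unchanged.\<close>
  define D where "D = C + (1 + 2 * R) ^ ?d * (C + 2 ^ ?d * M * C)"
  have "Lp_norm \<nu> p (\<lambda>x. \<integral>y. K x y * m ((x - y) /\<^sub>R \<epsilon>) * f y \<partial>\<mu>) \<le> ennreal (4 * D) * Lp_norm \<mu> p f"
    if e: "0 < \<epsilon>" and f: "bcs \<mu> f" for \<epsilon> f
  proof -
    obtain S where S: "compact S" "bsupp S f"
      using f by (auto simp: bcs_def bsupp_def meas)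
    have "multiplier (\<lambda>z. m ((fst z - snd z) /\<^sub>R \<epsilon>))
        (C + ((\<epsilon> + 2 * (R * \<epsilon>)) / \<epsilon>) ^ ?d * (C + 2 ^ ?d * M * C))"
    proof (rule multiplier_compactly_perturbed)
      show "dbound \<epsilon> M ?d (\<lambda>z. m (z /\<^sub>R \<epsilon>))"
        using dbound_scale[OF e M] by simp
      show "m (z /\<^sub>R \<epsilon>) = 1" if "R * \<epsilon> < norm z" for z
        using that e by (intro R(2)) (simp add: field_simps)
    qed (use e R in auto)
    moreover have "(\<epsilon> + 2 * (R * \<epsilon>)) / \<epsilon> = 1 + 2 * R"
      using e by (simp add: field_simps)
    ultimately have "multiplier (\<lambda>z. m ((fst z - snd z) /\<^sub>R \<epsilon>)) D"
      by (simp only: D_def)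
    \<comment> \<open>The width \<open>r * \<epsilon>\<close> of the vanishing region shrinks with
      \<epsilon>, but \<open>near_diagonal_operator_bound\<close> gives \<open>4 * D\<close>
      whatever the width.\<close>
    moreover have "m ((x - y) /\<^sub>R \<epsilon>) = 0" if "norm (x - y) < r * \<epsilon>" for x y
      using that e by (intro r(2)) (simp only: norm_scaleR, simp add: field_simps)
    ultimately show ?thesis
      using near_diagonal_operator_bound[of "\<lambda>z. m ((fst z - snd z) /\<^sub>R \<epsilon>)" D "r * \<epsilon>" S f] S r(1) e by simp
  qed
  then show ?thesis
    by blast
qed

end
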